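(* Let $\mathcal{C}=(V,\mathcal{R})$ be a scheme (coherent configuration, not necessarily homogeneous). Then $\mathcal{C}$ is a $2$-scheme if and only if each basis graph of $\mathcal{C}$ is bipartite.
   Context: All sets are finite. A relation on $V$ is a subset $R\subseteq V\times V$; $\Delta(V)=\{(v,v):v\in V\}$; $R^T=\{(u,v):(v,u)\in R\}$. The support $V_R$ of a relation $R$ is the smallest $X\subseteq V$ with $R\subseteq X\times X$. Scheme: let $V$ be a finite nonempty set and $\mathcal{R}$ a partition of $V\times V$ (into nonempty relations) closed under $R\mapsto R^T$. Let $\mathcal{R}^*$ be the set of all unions of elements of $\mathcal{R}$. The pair $\mathcal{C}=(V,\mathcal{R})$ is a scheme if $\Delta(V)\in\mathcal{R}^*$ and for all $R,S,T\in\mathcal{R}$ the number $c_{R,S}^T=|\{v\in V:(u,v)\in R,\ (v,w)\in S\}|$ does not depend on the choice of $(u,w)\in T$. The elements of $\mathcal{R}$ are the basis relations. A scheme is a $2$-scheme if $|R|$ is a power of $2$ (with $2^0=1$ allowed) for every $R\in\mathcal{R}$. The basis graphs of $\mathcal{C}$ are the undirected loopless graphs $(V_R,R)$ where $R=(S\cup S^T)\setminus\Delta(V)$ for some $S\in\mathcal{R}$. A graph is bipartite if its vertex set can be split into two disjoint (possibly empty) parts with no edge inside a part; in particular the empty graph is bipartite. *)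

theory Defs
  imports "HOL-Library.Disjoint_Sets" "Graph_Theory.Pair_Digraph"
begin

definition unions :: "'a set set \<Rightarrow> 'a set set" where
  "unions \<R> = {\<Union>\<X> |\<X>. \<X> \<subseteq> \<R>}"

definition path_count :: "'a set \<Rightarrow> 'a rel \<Rightarrow> 'a rel \<Rightarrow> 'a \<Rightarrow> 'a \<Rightarrow> nat" where
  "path_count V R S u w = card {v \<in> V. (u, v) \<in> R \<and> (v, w) \<in> S}"

text \<open>A scheme is a not necessarily homogeneous coherent configuration: the diagonal need only
  be a union of basis relations. Note that \<^const>\<open>partition_on\<close> requires nonempty parts.\<close>

locale scheme =
  fixes V :: "'a set" and \<R> :: "'a rel set"
  assumes finite_points: "finite V"
    and points_nonempty: "V \<noteq> {}"
    and partition: "partition_on (V \<times> V) \<R>"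
    and converse_closed: "R \<in> \<R> \<Longrightarrow> R\<inverse> \<in> \<R>"
    and diagonal: "Id_on V \<in> unions \<R>"
    and coherent: "\<lbrakk>R \<in> \<R>; S \<in> \<R>; T \<in> \<R>; (u, w) \<in> T; (u', w') \<in> T\<rbrakk>
      \<Longrightarrow> path_count V R S u w = path_count V R S u' w'"

definition two_scheme :: "'a set \<Rightarrow> 'a rel set \<Rightarrow> bool" where
  "two_scheme V \<R> \<longleftrightarrow> scheme V \<R> \<and> (\<forall>R\<in>\<R>. \<exists>k::nat. card R = 2 ^ k)"

definition rel_support :: "'a set \<Rightarrow> 'a rel \<Rightarrow> 'a set" where
  "rel_support V R = (LEAST X. X \<subseteq> V \<and> R \<subseteq> X \<times> X)"

lemma rel_support_eq_Field:
  assumes "R \<subseteq> V \<times> V"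
  shows "rel_support V R = Field R"
  unfolding rel_support_def using assms
  by (intro Least_equality) (auto simp: Field_def)

text \<open>Undirected graphs are represented by symmetric arc sets: each edge contributes both of its
  orientations.\<close>

definition basis_graph :: "'a set \<Rightarrow> 'a rel \<Rightarrow> 'a pair_pre_digraph" where
  "basis_graph V S =
    (let R = (S \<union> S\<inverse>) - Id_on V in \<lparr>pverts = rel_support V R, parcs = R\<rparr>)"

definition basis_graphs :: "'a set \<Rightarrow> 'a rel set \<Rightarrow> 'a pair_pre_digraph set" where
  "basis_graphs V \<R> = basis_graph V ` \<R>"

definition bipartite :: "'a pair_pre_digraph \<Rightarrow> bool" where
  "bipartite G \<longleftrightarrow> (\<exists>A B. A \<union> B = pverts G \<and> A \<inter> B = {} \<and>
    (\<forall>(u, v) \<in> parcs G. \<not> (u \<in> A \<and> v \<in> A) \<and> \<not> (u \<in> B \<and> v \<in> B)))"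

lemma (in scheme) basis_graph_pair_graph:
  assumes "G \<in> basis_graphs V \<R>"
  shows "pair_graph G"
proof -
  obtain S where S: "S \<in> \<R>" and G: "G = basis_graph V S"
    using assms by (auto simp: basis_graphs_def)
  define R where "R = (S \<union> S\<inverse>) - Id_on V"
  have "S \<subseteq> V \<times> V"
    using S partition by (auto simp: partition_on_def)
  then have R: "R \<subseteq> V \<times> V"
    by (auto simp: R_def)
  have G': "pverts G = Field R" "parcs G = R"
    using rel_support_eq_Field[OF R] by (simp_all add: G basis_graph_def R_def Let_def)
  have fin: "finite R"
    using R finite_points by (meson finite_SigmaI finite_subset)
  have sym: "sym R"
    by (auto simp: R_def sym_def)
  have loop: "u \<noteq> v" if "(u, v) \<in> R" for u v
    using that R by (auto simp: R_def)
  show ?thesis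
  proof
    show "finite (pverts G)"
      unfolding G' using fin by (rule finite_Field)
    show "symmetric (with_proj G)"
      using sym by (simp add: symmetric_def G')
  qed (use fin loop in \<open>auto simp: G' Field_def\<close>)
qed

end

theory Submission
  imports Defs "HOL-Number_Theory.Cong"
begin

text \<open>
  Both conditions of the theorem amount to the existence of a particular chain of equivalence
  relations on every fibre of the scheme, that is, on every set \<open>X\<close> whose diagonal is a basis
  relation. A \<^emph>\<open>tower\<close> on \<open>X\<close> is a chain of equivalences on \<open>X\<close>, each a union of basis relations,
  which starts at the diagonal and in which every class of a member is a single class of the
  preceding member or the union of two of them. Suppose that such a chain reaches \<open>X \<times> X\<close>.

  \<^item> The basis relations on \<open>X\<close> are bipartite (\<open>tower_bicolourable\<close>): an irreflexive one lies in
    some member of the chain and is disjoint from the preceding one, so all its pairs join the two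
    halves of a class.

  \<^item> All basis relations \<open>R\<close> that end in \<open>X\<close> have 2-power out-degree
    (\<open>neighbourhood_power_of_two\<close>): by coherence the set \<open>N\<close> of the \<open>R\<close>-neighbours of a point meets
    every class that it meets at all in the same number of points, and this number is kept or
    doubled from one member of the chain to the next.

  It remains to find towers. For a homogeneous 2-scheme (\<open>tower_full\<close>) a member \<open>E\<close> of the chain
  with classes of size \<open>m\<close> is enlarged by looking at the double cosets \<open>E O R O E\<close>. Counting pairs of
  \<open>R\<close> between classes shows that each has as out-degree a 2-power multiple of \<open>m\<close>, and these
  multiples add up to an even number unless \<open>E\<close> is everything. Pairing each double coset with its
  converse produces a symmetric double coset \<open>D \<noteq> E\<close> of out-degree \<open>m\<close>, and \<open>E \<union> D\<close> is the next
  member. For groups this is the fact that a proper subgroup of a 2-group has index two in some larger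
  subgroup.

  For a homogeneous scheme all of whose nondiagonal basis relations are bipartite, it suffices
  to show that it is a 2-scheme (\<open>homogeneous_bicolourable_power_of_two\<close>). The number of points is a
  power of two by an analogue of Cauchy's theorem (\<open>card_power_of_two_if_bicolourable\<close>): if an odd
  prime \<open>q\<close> divided it, then McKay's argument, with closed walks of length \<open>q\<close> classified by the
  cyclic words of relations that they follow, would give an odd closed walk inside a single
  nondiagonal basis relation. For the degree of a nondiagonal \<open>R\<close> consider the equivalence of being
  joined by an even number of steps along \<open>R\<close> in either direction. Its classes are proper subsets
  because \<open>R\<close> is bipartite, and one class contains all \<open>R\<close>-neighbours of a given point. The scheme
  restricted to this class inherits the hypothesis, hence is a 2-scheme by induction, hence has a
  tower, and so the number of neighbours is a power of two.
\<close>

section \<open>Cyclic symmetry of prime order and powers of two\<close>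

text \<open>The orbits of \<open>g\<close> on \<open>S\<close> have one or \<open>q\<close> elements, and an orbit of \<open>q\<close> elements contributes
  a multiple of \<open>q\<close>. The proof removes such orbits one at a time.\<close>

lemma sum_cong_fixed_points:
  fixes f :: "'b \<Rightarrow> nat"
  assumes q: "prime q"
  shows "finite S \<Longrightarrow> (\<And>x. x \<in> S \<Longrightarrow> g x \<in> S) \<Longrightarrow> (\<And>x. x \<in> S \<Longrightarrow> (g ^^ q) x = x)
    \<Longrightarrow> (\<And>x. x \<in> S \<Longrightarrow> f (g x) = f x)
    \<Longrightarrow> [sum f S = sum f {x \<in> S. g x = x}] (mod q)"
proof (induction "card S" arbitrary: S rule: less_induct)
  case less
  note S = less.prems
  show ?case
  proof (cases "\<forall>x\<in>S. g x = x")
    case True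
    then have "{x \<in> S. g x = x} = S" by auto
    then show ?thesis by simp
  next
    case False
    then obtain x where x: "x \<in> S" "g x \<noteq> x" by auto
    define orb where "orb = (\<lambda>i. (g ^^ i) x) ` {..<q}"
    have it: "(g ^^ i) y \<in> S" if "y \<in> S" for i y
      using that S(2) by (induction i) auto
    have f_it: "f ((g ^^ i) x) = f x" for i
      using it[OF x(1)] S(4) by (induction i) auto
    have per: "(g ^^ (q * k)) y = y" if "y \<in> S" for k y
      using that S(3) by (induction k) (auto simp: funpow_add)
    have per': "(g ^^ (d * k)) y = y" if "(g ^^ d) y = y" for d k y
      using that by (induction k) (auto simp: funpow_add)
    have inj: "inj_on (\<lambda>i. (g ^^ i) x) {..<q}"
    proof (rule linorder_inj_onI)
      fix i j assume ij: "i < j" "i \<in> {..<q}" "j \<in> {..<q}"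
      show "(g ^^ i) x \<noteq> (g ^^ j) x"
      proof
        assume eq: "(g ^^ i) x = (g ^^ j) x"
        \<comment> \<open>Another \<open>q - i\<close> applications of \<open>g\<close> bring the left-hand side back to \<open>x\<close>.\<close>
        have "(g ^^ (q - i)) ((g ^^ i) x) = (g ^^ (q - i)) ((g ^^ j) x)" by (simp add: eq)
        then have "(g ^^ (q - i + i)) x = (g ^^ (q - i + j)) x" by (simp only: funpow_add comp_apply)
        moreover have "q - i + j = (j - i) + q" using ij by auto
        ultimately have fix_d: "(g ^^ (j - i)) x = x"
          using ij S(3)[OF x(1)]
          by (simp only: funpow_add comp_apply lessThan_iff le_add_diff_inverse2 less_imp_le)
        \<comment> \<open>The period \<open>j - i\<close> is coprime to the period \<open>q\<close>, so \<open>x\<close> is fixed.\<close>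
        have "\<not> q dvd (j - i)" using ij by (auto dest!: dvd_imp_le)
        then have "coprime (j - i) q" 
          using prime_imp_coprime[OF q] by (metis coprime_commute)
        then obtain a b where ab: "(j - i) * a = q * b + 1"
          using bezout_nat[of "j - i" q] ij by auto
        have "x = (g ^^ ((j - i) * a)) x" using per'[OF fix_d] by simp
        also have "\<dots> = g ((g ^^ (q * b)) x)" by (simp add: ab)
        also have "\<dots> = g x" using per[OF x(1)] by simp
        finally show False using x by simp
      qed
    qed (auto)
    have orb_S: "orb \<subseteq> S" using it[OF x(1)] by (auto simp: orb_def)
    have fin_orb: "finite orb" by (simp add: orb_def)
    have x_orb: "x \<in> orb" using prime_gt_0_nat[OF q] by (auto simp: orb_def intro!: image_eqI[of _ _ 0])
    have "sum f orb = (\<Sum>i<q. f ((g ^^ i) x))" by (simp add: orb_def sum.reindex[OF inj])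
    then have sum_orb: "sum f orb = q * f x" by (simp add: f_it)
    have g_orb: "g y \<in> orb" if y: "y \<in> orb" for y
    proof -
      obtain i where i: "i < q" "y = (g ^^ i) x" using y by (auto simp: orb_def)
      show ?thesis
      proof (cases "Suc i < q")
        case True then show ?thesis using i by (auto simp: orb_def intro!: image_eqI[of _ _ "Suc i"])
      next
        case False
        then have "Suc i = q" using i by simp
        then have "g y = x" using S(3)[OF x(1)] i by (metis funpow.simps(2) comp_apply)
        then show ?thesis using x_orb by simp
      qed
    qed
    have moved: "g y \<noteq> y" if y: "y \<in> orb" for y
    proof
      assume "g y = y"
      obtain i where i: "i < q" "y = (g ^^ i) x" using y by (auto simp: orb_def)
      have fixy: "(g ^^ k) y = y" for k using \<open>g y = y\<close> by (induction k) auto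
      have "x = (g ^^ (q - i + i)) x" using i S(3)[OF x(1)] by simp
      also have "\<dots> = (g ^^ (q - i)) y" unfolding i(2) funpow_add by simp
      finally have "x = y" using fixy by simp
      then show False using \<open>g y = y\<close> x by simp
    qed
    have g_diff: "g y \<in> S - orb" if "y \<in> S - orb" for y
    proof -
      have "y \<in> orb" if "g y \<in> orb"
      proof -
        have "(g ^^ k) (g y) \<in> orb" for k using that g_orb by (induction k) auto
        moreover have "(g ^^ (q - 1)) (g y) = (g ^^ q) y"
          using prime_gt_0_nat[OF q] by (cases q) (simp_all add: funpow_swap1)
        ultimately show ?thesis using S(3) \<open>y \<in> S - orb\<close> by (metis DiffD1)
      qed
      then show ?thesis using that S(2) by auto
    qed
    have "[sum f (S - orb) = sum f {x \<in> S - orb. g x = x}] (mod q)"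
    proof (rule less.hyps)
      show "card (S - orb) < card S" using S(1) x x_orb by (intro psubset_card_mono) auto
    qed (use S g_diff in auto)
    moreover have "{x \<in> S - orb. g x = x} = {x \<in> S. g x = x}" using moved by auto
    moreover have "sum f S = sum f (S - orb) + q * f x"
      using sum.subset_diff[OF orb_S S(1), of f] sum_orb by simp
    ultimately show ?thesis by (simp add: cong_def)
  qed
qed

lemma rotate1_fixed_iff_constant:
  assumes "length xs > 0"
  shows "rotate1 xs = xs \<longleftrightarrow> (\<exists>x. xs = replicate (length xs) x)"
proof
  assume rot: "rotate1 xs = xs"
  have "xs ! i = xs ! 0" if "i < length xs" for i
    using that
  proof (induction i)
    case (Suc i)
    have "xs ! i = rotate1 xs ! i" using rot by simp
    also have "\<dots> = xs ! Suc i" using Suc.prems by (simp add: nth_rotate1)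
    finally show ?case using Suc by simp
  qed simp
  then have "xs = replicate (length xs) (xs ! 0)" by (intro nth_equalityI) auto
  then show "\<exists>x. xs = replicate (length xs) x" by blast
next
  assume "\<exists>x. xs = replicate (length xs) x"
  then obtain x where x: "xs = replicate (length xs) x" by blast
  have "rotate1 (replicate n x) = replicate n x" for n
    by (cases n) (simp_all add: replicate_append_same)
  then show "rotate1 xs = xs" using x by metis
qed

definition power_of_two :: "nat \<Rightarrow> bool" where
  "power_of_two n \<longleftrightarrow> (\<exists>k. n = 2 ^ k)"

lemma power_of_two_1 [simp]: "power_of_two 1" "power_of_two (Suc 0)"
  by (auto simp: power_of_two_def intro: exI[of _ 0])

lemma power_of_two_2: "power_of_two 2"
  unfolding power_of_two_def by (rule exI[of _ 1]) simp

lemma power_of_two_mult: "power_of_two a \<Longrightarrow> power_of_two b \<Longrightarrow> power_of_two (a * b)"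
  by (auto simp: power_of_two_def simp flip: power_add)

lemma power_of_two_dvd: "power_of_two b \<Longrightarrow> a dvd b \<Longrightarrow> power_of_two a"
  unfolding power_of_two_def using divides_primepow_nat[OF two_is_prime_nat] by blast

lemma power_of_two_pos: "power_of_two a \<Longrightarrow> a > 0"
  by (auto simp: power_of_two_def)

lemma power_of_two_le_imp_dvd: "power_of_two a \<Longrightarrow> power_of_two b \<Longrightarrow> a \<le> b \<Longrightarrow> a dvd b"
  by (auto simp: power_of_two_def le_imp_power_dvd)

lemma power_of_two_odd: "power_of_two a \<Longrightarrow> odd a \<Longrightarrow> a = 1"
  by (auto simp: power_of_two_def)

lemma power_of_two_if_no_odd_prime:
  assumes "n > 0" "\<And>q::nat. prime q \<Longrightarrow> odd q \<Longrightarrow> \<not> q dvd n"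
  shows "power_of_two n"
proof -
  obtain m where m: "n = 2 ^ multiplicity 2 n * m" "\<not> 2 dvd m"
    using multiplicity_decompose'[of n 2] assms(1) by auto
  have "m = 1"
  proof (rule ccontr)
    assume "m \<noteq> 1"
    then obtain q where "prime q" "q dvd m" using prime_factor_nat by blast
    moreover have "odd q" using \<open>q dvd m\<close> m(2) by (meson dvd_trans)
    ultimately show False using assms(2)[of q] m(1) by (metis dvd_mult)
  qed
  then show ?thesis using m(1) by (auto simp: power_of_two_def)
qed

section \<open>Two-colourings\<close>

text \<open>A colouring by truth values instead of a partition into two sets: such colourings restrict to
  subrelations without any adjustment of the vertex set, and \<open>R\<close> may be directed.\<close>

definition bicolourable :: "'a rel \<Rightarrow> bool" where
  "bicolourable R \<longleftrightarrow> (\<exists>c :: 'a \<Rightarrow> bool. \<forall>u v. (u, v) \<in> R \<longrightarrow> c u \<noteq> c v)"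

lemma bicolourableI:
  fixes c :: "'a \<Rightarrow> bool"
  shows "(\<And>u v. (u, v) \<in> R \<Longrightarrow> c u \<noteq> c v) \<Longrightarrow> bicolourable R"
  unfolding bicolourable_def by (rule exI[of _ c]) simp

lemma bicolourableE:
  fixes R :: "'a rel"
  assumes "bicolourable R"
  obtains c :: "'a \<Rightarrow> bool" where "\<And>u v. (u, v) \<in> R \<Longrightarrow> c u \<noteq> c v"
  using assms unfolding bicolourable_def by (elim exE) (rule that, elim allE impE)

lemma bicolourable_mono: "bicolourable S \<Longrightarrow> R \<subseteq> S \<Longrightarrow> bicolourable R"
  by (erule bicolourableE, rule bicolourableI) (drule subsetD, assumption)

text \<open>Direction is immaterial for colourings, and the points outside the support of \<open>S - Id\<close> can
  be coloured arbitrarily.\<close>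

lemma bipartite_basis_graph_iff:
  fixes S :: "'a rel"
  assumes S: "S \<subseteq> V \<times> V"
  shows "bipartite (basis_graph V S) \<longleftrightarrow> bicolourable (S - Id)"
proof -
  define R where "R = (S \<union> S\<inverse>) - Id_on V"
  have R: "R \<subseteq> V \<times> V" using S by (auto simp: R_def)
  have G: "pverts (basis_graph V S) = Field R" "parcs (basis_graph V S) = R"
    using rel_support_eq_Field[OF R] by (simp_all add: basis_graph_def R_def Let_def)
  have R_iff: "(u, v) \<in> R \<longleftrightarrow> u \<noteq> v \<and> ((u, v) \<in> S \<or> (v, u) \<in> S)" for u v
    using S by (auto simp: R_def)
  show ?thesis
  proof
    assume "bipartite (basis_graph V S)"
    then obtain A B where AB: "A \<union> B = Field R"
      "\<forall>(u, v) \<in> R. \<not> (u \<in> A \<and> v \<in> A) \<and> \<not> (u \<in> B \<and> v \<in> B)"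
      unfolding bipartite_def G by (elim exE conjE) (rule that, assumption+)
    have "(u \<in> A) \<noteq> (v \<in> A)" if "(u, v) \<in> S - Id" for u v
    proof -
      have uv: "(u, v) \<in> R" using that by (auto simp: R_iff)
      then have "u \<in> A \<union> B" "v \<in> A \<union> B" unfolding AB(1) by (auto simp: Field_def)
      then show ?thesis using bspec[OF AB(2) uv] by auto
    qed
    then show "bicolourable (S - Id)"
      by (rule bicolourableI)
  next
    assume "bicolourable (S - Id)"
    then obtain c :: "'a \<Rightarrow> bool" where c: "\<And>u v. (u, v) \<in> S - Id \<Longrightarrow> c u \<noteq> c v"
      by (rule bicolourableE) (rule that)
    have R_c: "c u \<noteq> c v" if "(u, v) \<in> R" for u v
      using c[of u v] c[of v u] that by (auto simp: R_iff)
    show "bipartite (basis_graph V S)" unfolding bipartite_def G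
      by (intro exI[of _ "{u \<in> Field R. c u}"] exI[of _ "{u \<in> Field R. \<not> c u}"])
        (auto dest: R_c)
  qed
qed

section \<open>Towers of equivalences\<close>

text \<open>The last premise of \<open>step\<close> says that each class of \<open>F\<close> consists of at most two classes of
  \<open>E\<close>: whoever leaves a class of \<open>E\<close> twice within \<open>F\<close> is back. The parameter \<open>\<U>\<close> stands for the
  unions of basis relations; keeping it abstract separates the arguments about chains from those
  about coherence.\<close>

inductive tower :: "'a set \<Rightarrow> 'a rel set \<Rightarrow> 'a rel \<Rightarrow> bool" for X \<U> where
  base: "Id_on X \<in> \<U> \<Longrightarrow> tower X \<U> (Id_on X)"
| step: "\<lbrakk>tower X \<U> E; F \<in> \<U>; equiv X F; E \<subseteq> F;
    \<And>x y z. \<lbrakk>(x, y) \<in> F - E; (y, z) \<in> F - E\<rbrakk> \<Longrightarrow> (x, z) \<in> E\<rbrakk> \<Longrightarrow> tower X \<U> F"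

lemma tower_mem: "tower X \<U> E \<Longrightarrow> E \<in> \<U>"
  by (cases rule: tower.cases) auto

lemma tower_equiv: "tower X \<U> E \<Longrightarrow> equiv X E"
  by (cases rule: tower.cases) (auto intro!: equivI simp: refl_on_def sym_def trans_def)

text \<open>If \<open>N\<close> meets the second half of the class \<open>F `` {x}\<close>, say in \<open>y\<close>, then that half is the class
  \<open>E `` {y}\<close>, which contains as many points of \<open>N\<close> as \<open>E `` {x}\<close>. So passing from \<open>E\<close> to \<open>F\<close> keeps
  the number of points or doubles it.\<close>

lemma tower_equitable_power_of_two:
  assumes "tower X \<U> E" and N: "N \<subseteq> X" "finite N"
    and const: "\<And>E x y. \<lbrakk>E \<in> \<U>; x \<in> N; y \<in> N\<rbrakk> \<Longrightarrow> card (N \<inter> E `` {x}) = card (N \<inter> E `` {y})"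
  shows "x \<in> N \<Longrightarrow> power_of_two (card (N \<inter> E `` {x}))"
  using assms(1)
proof (induction arbitrary: x)
  case base
  then have "N \<inter> Id_on X `` {x} = {x}" using N by auto
  then show ?case by simp
next
  case (step E F)
  have E: "equiv X E" "E \<in> \<U>" using step.hyps(1) by (auto intro: tower_equiv tower_mem)
  have IH: "power_of_two (card (N \<inter> E `` {x}))" using step by blast
  show ?case
  proof (cases "N \<inter> (F `` {x} - E `` {x}) = {}")
    case True
    then have "N \<inter> F `` {x} = N \<inter> E `` {x}" using step.hyps(4) by auto
    then show ?thesis using IH by simp
  next
    case False
    then obtain y where y: "y \<in> N" "(x, y) \<in> F" "(x, y) \<notin> E" by auto
    have symF: "sym F" "trans F" "sym E" "trans E"
      using step.hyps(3) E(1) by (auto simp: equiv_def)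
    have "F `` {x} = E `` {x} \<union> E `` {y}"
    proof (intro equalityI subsetI)
      fix z assume "z \<in> F `` {x}"
      then have z: "(x, z) \<in> F" by simp
      show "z \<in> E `` {x} \<union> E `` {y}"
      proof (cases "(x, z) \<in> E")
        case False
        have "(y, x) \<in> F - E" using y symF by (auto simp: sym_def)
        then have "(y, z) \<in> E" using step.hyps(5)[of y x z] z False by auto
        then show ?thesis by auto
      qed auto
    next
      fix z assume "z \<in> E `` {x} \<union> E `` {y}"
      then show "z \<in> F `` {x}" using y step.hyps(4) symF(2) by (auto dest: transD)
    qed
    moreover have "E `` {x} \<inter> E `` {y} = {}"
      using y(3) symF(3,4) by (blast dest: symD transD)
    ultimately have "card (N \<inter> F `` {x}) = card (N \<inter> E `` {x}) + card (N \<inter> E `` {y})"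
      using N(2) by (subst card_Un_disjoint[symmetric]) (auto intro!: arg_cong[of _ _ card])
    also have "\<dots> = 2 * card (N \<inter> E `` {x})"
      using const[OF E(2) y(1) step.prems] by simp
    finally show ?thesis
      using power_of_two_mult[OF power_of_two_2 IH] by simp
  qed
qed

text \<open>At the first member \<open>F\<close> that contains \<open>R\<close>, the relation avoids the preceding member \<open>E\<close>, so its
  pairs join different halves of the classes of \<open>F\<close>; the colour of a point tells in which half it
  lies.\<close>

lemma tower_bicolourable:
  assumes "tower X \<U> E" and dich: "\<And>E. E \<in> \<U> \<Longrightarrow> R \<subseteq> E \<or> R \<inter> E = {}"
  shows "R \<subseteq> E \<Longrightarrow> R \<inter> Id = {} \<Longrightarrow> bicolourable R"
  using assms(1)
proof induction
  case base
  then have "R = {}" by auto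
  then show ?case by (auto intro: bicolourableI)
next
  case (step E F)
  show ?case
  proof (cases "R \<subseteq> E")
    case True then show ?thesis using step by blast
  next
    case False
    then have disj: "R \<inter> E = {}" using dich tower_mem[OF step.hyps(1)] by blast
    have E: "equiv X E" using step.hyps(1) by (rule tower_equiv)
    \<comment> \<open>The choice depends on the class of \<open>v\<close> only, so it marks one half of each class of \<open>F\<close>.\<close>
    define r where "r v = (SOME w. w \<in> F `` {v})" for v
    have r: "(v, r v) \<in> F" if "v \<in> X" for v
    proof -
      have "v \<in> F `` {v}" using equiv_class_self[OF step.hyps(3) that] .
      then have "r v \<in> F `` {v}" unfolding r_def by (rule someI)
      then show ?thesis by simp
    qed
    have "((u, r u) \<in> E) \<noteq> ((v, r v) \<in> E)" if uv: "(u, v) \<in> R" for u v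
    proof -
      have F: "(u, v) \<in> F" "(u, v) \<notin> E" using uv step.prems disj by auto
      then have X: "u \<in> X" "v \<in> X" using step.hyps(3) by (auto simp: equiv_def)
      have "F `` {u} = F `` {v}" using equiv_class_eq[OF step.hyps(3) F(1)] .
      then have eq: "r u = r v" by (simp add: r_def)
      have sE: "sym E" "trans E" using E by (auto simp: equiv_def)
      have sF: "sym F" using step.hyps(3) by (auto simp: equiv_def)
      have "(u, v) \<in> E" if "(u, r u) \<in> E" "(v, r v) \<in> E"
        using that eq sE by (metis symD transD)
      moreover have "(u, v) \<in> E" if "(u, r u) \<notin> E" "(v, r v) \<notin> E"
      proof (rule step.hyps(5))
        show "(u, r u) \<in> F - E" using r[OF X(1)] that by auto
        show "(r u, v) \<in> F - E" using r[OF X(2)] that eq sF sE by (metis DiffI symD)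
      qed
      ultimately show ?thesis using F(2) by auto
    qed
    then show ?thesis by (rule bicolourableI)
  qed
qed

section \<open>The adjacency algebra\<close>

lemma sum_of_bool_card: "finite A \<Longrightarrow> (\<Sum>x\<in>A. of_bool (P x)) = card {x \<in> A. P x}"
  by (simp add: Int_def)

context scheme
begin

lemma basis_subset: "R \<in> \<R> \<Longrightarrow> R \<subseteq> V \<times> V"
  using partition_onD1[OF partition] by auto

lemma basis_nonempty: "R \<in> \<R> \<Longrightarrow> R \<noteq> {}"
  using partition_onD3[OF partition] by auto

lemma basis_cover: "u \<in> V \<Longrightarrow> w \<in> V \<Longrightarrow> \<exists>T\<in>\<R>. (u, w) \<in> T"
  using partition_onD1[OF partition] by auto

lemma basis_eq: "\<lbrakk>R \<in> \<R>; S \<in> \<R>; p \<in> R; p \<in> S\<rbrakk> \<Longrightarrow> R = S"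
  using partition_onD2[OF partition] by (auto dest: disjointD)

lemma finite_basis: "finite \<R>"
  using finite_points finite_elements[OF _ partition] by simp

lemma finite_rel: "E \<subseteq> V \<times> V \<Longrightarrow> finite E"
  using finite_points by (meson finite_SigmaI finite_subset)

lemma unions_iff: "E \<in> unions \<R> \<longleftrightarrow> E \<subseteq> V \<times> V \<and> (\<forall>T\<in>\<R>. T \<subseteq> E \<or> T \<inter> E = {})"
proof
  assume "E \<in> unions \<R>"
  then obtain \<X> where X: "\<X> \<subseteq> \<R>" "E = \<Union>\<X>" by (auto simp: unions_def)
  have "T \<subseteq> E" if T: "T \<in> \<R>" "T \<inter> E \<noteq> {}" for T
  proof -
    obtain p S where p: "p \<in> T" "p \<in> S" "S \<in> \<X>" using T X by blast
    then have "T = S" using basis_eq[OF T(1)] X by blast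
    then show ?thesis using X p by blast
  qed
  then show "E \<subseteq> V \<times> V \<and> (\<forall>T\<in>\<R>. T \<subseteq> E \<or> T \<inter> E = {})"
    using X basis_subset by blast
next
  assume E: "E \<subseteq> V \<times> V \<and> (\<forall>T\<in>\<R>. T \<subseteq> E \<or> T \<inter> E = {})"
  have "E \<subseteq> \<Union>{T \<in> \<R>. T \<subseteq> E}"
  proof
    fix p assume p: "p \<in> E"
    moreover obtain T where T: "T \<in> \<R>" "p \<in> T"
      using subsetD[OF conjunct1[OF E] p] unfolding partition_onD1[OF partition] by blast
    moreover have "T \<inter> E \<noteq> {}" using p T(2) by blast
    ultimately have "T \<subseteq> E" using E by metis
    then show "p \<in> \<Union>{T \<in> \<R>. T \<subseteq> E}" using T by blast
  qed
  then have "E = \<Union>{T \<in> \<R>. T \<subseteq> E}" by blast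
  then show "E \<in> unions \<R>" unfolding unions_def by blast
qed

lemma unions_subset: "E \<in> unions \<R> \<Longrightarrow> E \<subseteq> V \<times> V"
  by (simp add: unions_iff)

lemma unions_dichotomy: "E \<in> unions \<R> \<Longrightarrow> T \<in> \<R> \<Longrightarrow> T \<subseteq> E \<or> T \<inter> E = {}"
  by (simp add: unions_iff)

lemma basis_in_unions: "R \<in> \<R> \<Longrightarrow> R \<in> unions \<R>"
  unfolding unions_def by blast

lemma full_in_unions: "V \<times> V \<in> unions \<R>"
  using basis_subset by (auto simp: unions_iff)

lemma Union_in_unions: "(\<And>E. E \<in> \<E> \<Longrightarrow> E \<in> unions \<R>) \<Longrightarrow> \<Union>\<E> \<in> unions \<R>"
  unfolding unions_iff by blast

lemma Un_in_unions: "E \<in> unions \<R> \<Longrightarrow> F \<in> unions \<R> \<Longrightarrow> E \<union> F \<in> unions \<R>"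
  using Union_in_unions[of "{E, F}"] by auto

lemma converse_in_unions:
  assumes "E \<in> unions \<R>" shows "E\<inverse> \<in> unions \<R>"
proof -
  have "T \<subseteq> E\<inverse> \<or> T \<inter> E\<inverse> = {}" if "T \<in> \<R>" for T
    using unions_dichotomy[OF assms converse_closed[OF that]] by auto
  then show ?thesis using unions_subset[OF assms] by (auto simp: unions_iff)
qed

text \<open>These functions, read as matrices, are the members of the adjacency algebra of the scheme with
  natural number entries. Coherence says that they are closed under matrix multiplication, and this
  is the form in which it is used throughout.\<close>

definition invariant :: "('a \<Rightarrow> 'a \<Rightarrow> nat) \<Rightarrow> bool" where
  "invariant f \<longleftrightarrow> (\<forall>T\<in>\<R>. \<forall>u w u' w'. (u, w) \<in> T \<longrightarrow> (u', w') \<in> T \<longrightarrow> f u w = f u' w')"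

lemma invariantD: "\<lbrakk>invariant f; T \<in> \<R>; (u, w) \<in> T; (u', w') \<in> T\<rbrakk> \<Longrightarrow> f u w = f u' w'"
  unfolding invariant_def by blast

lemma invariant_of_bool:
  assumes "E \<in> unions \<R>"
  shows "invariant (\<lambda>u w. of_bool ((u, w) \<in> E))"
  unfolding invariant_def
proof (intro ballI allI impI)
  fix T u w u' w' assume T: "T \<in> \<R>" "(u, w) \<in> T" "(u', w') \<in> T"
  then have "(u, w) \<in> E \<longleftrightarrow> (u', w') \<in> E" using unions_dichotomy[OF assms T(1)] by blast
  then show "(of_bool ((u, w) \<in> E) :: nat) = of_bool ((u', w') \<in> E)" by simp
qed

lemma level_set_in_unions:
  assumes "invariant f"
  shows "{(u, w) \<in> V \<times> V. P (f u w)} \<in> unions \<R>"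
proof -
  have "T \<subseteq> {(u, w) \<in> V \<times> V. P (f u w)}"
    if T: "T \<in> \<R>" "T \<inter> {(u, w) \<in> V \<times> V. P (f u w)} \<noteq> {}" for T
  proof -
    obtain u w where uw: "(u, w) \<in> T" "P (f u w)" using T by blast
    have "P (f u' w')" if "(u', w') \<in> T" for u' w'
      using invariantD[OF assms T(1) uw(1) that] uw(2) by simp
    then show ?thesis using basis_subset[OF T(1)] by auto
  qed
  then show ?thesis unfolding unions_iff by blast
qed

text \<open>Expanding both factors in the basis of the adjacency matrices reduces the product to the
  intersection numbers of the scheme.\<close>

lemma invariant_product:
  assumes f: "invariant f" and g: "invariant g"
  shows "invariant (\<lambda>u w. \<Sum>v\<in>V. f u v * g v w)"
  unfolding invariant_def
proof (intro ballI allI impI)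
  fix T u w u' w' assume T: "T \<in> \<R>" "(u, w) \<in> T" "(u', w') \<in> T"
  define val where "val h R = (case SOME p. p \<in> R of (x, y) \<Rightarrow> h x y)"
    for h :: "'a \<Rightarrow> 'a \<Rightarrow> nat" and R :: "'a rel"
  have val: "val h R = h x y" if "invariant h" "R \<in> \<R>" "(x, y) \<in> R" for h R x y
  proof -
    obtain x' y' where xy: "(SOME p. p \<in> R) = (x', y')" by force
    have "(SOME p. p \<in> R) \<in> R" using that(3) by (rule someI)
    then show ?thesis using invariantD[OF that(1,2) _ that(3)] by (simp add: val_def xy)
  qed
  have expand: "(\<Sum>v\<in>V. f a v * g v b) =
      (\<Sum>R\<in>\<R>. \<Sum>S\<in>\<R>. val f R * val g S * path_count V R S a b)"
    if ab: "a \<in> V" "b \<in> V" for a b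
  proof -
    have "f a v * g v b = (\<Sum>R\<in>\<R>. \<Sum>S\<in>\<R>. val f R * val g S * of_bool ((a, v) \<in> R \<and> (v, b) \<in> S))"
      if v: "v \<in> V" for v
    proof -
      obtain R S where RS: "R \<in> \<R>" "(a, v) \<in> R" "S \<in> \<R>" "(v, b) \<in> S"
        using basis_cover ab v by metis
      have 1: "of_bool ((a, v) \<in> R') = (of_bool (R' = R) :: nat)" if "R' \<in> \<R>" for R'
        using basis_eq[OF that RS(1) _ RS(2)] RS(2) by (cases "R' = R") auto
      have 2: "of_bool ((v, b) \<in> S') = (of_bool (S' = S) :: nat)" if "S' \<in> \<R>" for S'
        using basis_eq[OF that RS(3) _ RS(4)] RS(4) by (cases "S' = S") auto
      have "(\<Sum>R'\<in>\<R>. \<Sum>S'\<in>\<R>. val f R' * val g S' * of_bool ((a, v) \<in> R' \<and> (v, b) \<in> S')) =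
          (\<Sum>R'\<in>\<R>. \<Sum>S'\<in>\<R>. (val f R' * of_bool (R' = R)) * (val g S' * of_bool (S' = S)))"
        by (intro sum.cong refl) (simp add: of_bool_conj 1 2)
      also have "\<dots> = (\<Sum>R'\<in>\<R>. val f R' * of_bool (R' = R)) * (\<Sum>S'\<in>\<R>. val g S' * of_bool (S' = S))"
        by (simp add: sum_product)
      also have "\<dots> = val f R * val g S"
        using RS finite_basis by (simp add: of_bool_def if_distrib cong: if_cong)
      also have "\<dots> = f a v * g v b" using val f g RS by metis
      finally show ?thesis by simp
    qed
    then have "(\<Sum>v\<in>V. f a v * g v b) =
      (\<Sum>v\<in>V. \<Sum>R\<in>\<R>. \<Sum>S\<in>\<R>. val f R * val g S * of_bool ((a, v) \<in> R \<and> (v, b) \<in> S))"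
      by (intro sum.cong) auto
    also have "\<dots> = (\<Sum>R\<in>\<R>. \<Sum>S\<in>\<R>. \<Sum>v\<in>V. val f R * val g S * of_bool ((a, v) \<in> R \<and> (v, b) \<in> S))"
      by (subst sum.swap, intro sum.cong refl, subst sum.swap) simp
    also have "\<dots> = (\<Sum>R\<in>\<R>. \<Sum>S\<in>\<R>. val f R * val g S * path_count V R S a b)"
      by (simp only: path_count_def sum_of_bool_card[OF finite_points] flip: sum_distrib_left)
    finally show ?thesis .
  qed
  have V: "u \<in> V" "w \<in> V" "u' \<in> V" "w' \<in> V" using basis_subset[OF T(1)] T by auto
  show "(\<Sum>v\<in>V. f u v * g v w) = (\<Sum>v\<in>V. f u' v * g v w')"
    unfolding expand[OF V(1,2)] expand[OF V(3,4)]
    using coherent[OF _ _ T(1) T(2) T(3)] by (intro sum.cong refl) simp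
qed

lemma path_count_sum: "path_count V A B u w = (\<Sum>v\<in>V. of_bool ((u, v) \<in> A) * of_bool ((v, w) \<in> B))"
  unfolding path_count_def sum_of_bool_card[OF finite_points, symmetric] of_bool_conj ..

lemma invariant_path_count:
  "A \<in> unions \<R> \<Longrightarrow> B \<in> unions \<R> \<Longrightarrow> invariant (path_count V A B)"
  unfolding path_count_sum by (intro invariant_product invariant_of_bool)

text \<open>The composition is the support of the product of the two adjacency matrices.\<close>

lemma relcomp_in_unions:
  assumes "A \<in> unions \<R>" "B \<in> unions \<R>"
  shows "A O B \<in> unions \<R>"
proof -
  have pos: "path_count V A B u w > 0 \<longleftrightarrow> (u, w) \<in> A O B" for u w
  proof -
    have "path_count V A B u w > 0 \<longleftrightarrow> (\<exists>v\<in>V. (u, v) \<in> A \<and> (v, w) \<in> B)"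
      using finite_points by (auto simp: path_count_def card_gt_0_iff)
    then show ?thesis using unions_subset[OF assms(1)] by (auto simp: relcomp_unfold)
  qed
  have "A O B \<subseteq> V \<times> V"
    using unions_subset[OF assms(1)] unions_subset[OF assms(2)] by (rule relcomp_subset_Sigma)
  then have "A O B = {(u, w) \<in> V \<times> V. path_count V A B u w > 0}"
    unfolding pos by auto
  then show ?thesis using level_set_in_unions[OF invariant_path_count[OF assms]] by simp
qed
lemma trancl_in_unions:
  assumes "A \<in> unions \<R>"
  shows "A\<^sup>+ \<in> unions \<R>"
proof -
  have "A ^^ Suc n \<in> unions \<R>" for n
  proof (induction n)
    case (Suc n)
    then show ?case using relcomp_in_unions[OF Suc assms] by simp
  qed (use assms in simp)
  then have pow: "A ^^ n \<in> unions \<R>" if "n > 0" for n using gr0_implies_Suc[OF that] by metis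
  have "\<Union>((\<lambda>n. A ^^ n) ` {0<..}) \<in> unions \<R>"
    by (rule Union_in_unions) (use pow in blast)
  moreover have "A\<^sup>+ = \<Union>((\<lambda>n. A ^^ n) ` {0<..})" by (auto simp: trancl_power)
  ultimately show ?thesis by simp
qed

section \<open>Fibres and restrictions\<close>

lemma basis_diagonal_or_irreflexive: "R \<in> \<R> \<Longrightarrow> R \<subseteq> Id_on V \<or> R \<inter> Id = {}"
  using unions_dichotomy[OF diagonal, of R] basis_subset[of R] by blast

text \<open>A fibre is a set \<open>X\<close> such that \<open>Id_on X\<close> is a basis relation; the scheme is homogeneous if \<open>V\<close>
  itself is a fibre.\<close>

lemma fibre_exists:
  assumes "v \<in> V"
  obtains X where "Id_on X \<in> \<R>" "v \<in> X"
proof -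
  obtain T where T: "T \<in> \<R>" "(v, v) \<in> T" using basis_cover[OF assms assms] by blast
  then have "T \<subseteq> Id_on V" using basis_diagonal_or_irreflexive[OF T(1)] by blast
  then have "T = Id_on (Domain T)" by auto
  then show thesis using that[of "Domain T"] T by auto
qed

lemma fibre_subset: "Id_on X \<in> \<R> \<Longrightarrow> X \<subseteq> V"
  using basis_subset by blast

lemma fibre_nonempty: "Id_on X \<in> \<R> \<Longrightarrow> X \<noteq> {}"
  using basis_nonempty by fastforce

lemma fibre_square_in_unions:
  assumes "Id_on X \<in> \<R>"
  shows "X \<times> X \<in> unions \<R>"
proof -
  have "X \<times> X = Id_on X O (V \<times> V) O Id_on X" using fibre_subset[OF assms] by auto
  then show ?thesis
    using assms by (simp only:) (intro relcomp_in_unions basis_in_unions full_in_unions)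
qed

lemma basis_Image_subset_fibre:
  assumes "R \<in> \<R>" "Id_on X \<in> \<R>" "(u, x) \<in> R" "x \<in> X"
  shows "R \<subseteq> V \<times> X"
proof -
  have "R O Id_on X \<in> unions \<R>" using assms by (intro relcomp_in_unions basis_in_unions)
  moreover have "(u, x) \<in> R O Id_on X" using assms by auto
  ultimately have "R \<subseteq> R O Id_on X" using unions_dichotomy[OF _ assms(1)] assms(3) by blast
  then show ?thesis using basis_subset[OF assms(1)] by auto
qed

lemma basis_between_fibres:
  assumes "R \<in> \<R>" "Id_on Z \<in> \<R>" "Id_on X \<in> \<R>" "(u, x) \<in> R" "u \<in> Z" "x \<in> X"
  shows "R \<subseteq> Z \<times> X"
proof -
  have "R \<subseteq> V \<times> X" using basis_Image_subset_fibre[OF assms(1,3,4,6)] .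
  moreover have "R\<inverse> \<subseteq> V \<times> Z"
    using basis_Image_subset_fibre[OF converse_closed[OF assms(1)] assms(2) _ assms(5), of x] assms(4) by simp
  ultimately show ?thesis by blast
qed

lemma invariant_diagonal:
  "\<lbrakk>invariant f; Id_on X \<in> \<R>; u \<in> X; v \<in> X\<rbrakk> \<Longrightarrow> f u u = f v v"
  using invariantD[of f "Id_on X" u u v v] by auto

text \<open>The out-degree is the diagonal entry of the product of \<open>R\<close> with the all-one matrix.\<close>

lemma out_degree_constant:
  assumes R: "R \<in> unions \<R>" and X: "Id_on X \<in> \<R>" "u \<in> X" "v \<in> X"
  shows "card (R `` {u}) = card (R `` {v})"
proof -
  have "card (R `` {w}) = path_count V R (V \<times> V) w w" if "w \<in> X" for w
    unfolding path_count_def using fibre_subset[OF X(1)] that unions_subset[OF R]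
    by (intro arg_cong[of _ _ card]) auto
  then show ?thesis
    using invariant_diagonal[OF invariant_path_count[OF R full_in_unions] X] X by simp
qed

lemma card_eq_fibre_times_out_degree:
  assumes R: "R \<in> unions \<R>" and X: "Id_on X \<in> \<R>" "u \<in> X" and sub: "R \<subseteq> X \<times> V"
  shows "card R = card X * card (R `` {u})"
proof -
  have fin: "finite X" using fibre_subset[OF X(1)] finite_points finite_subset by blast
  have "R = (SIGMA x:X. R `` {x})" using sub by auto
  then have "card R = (\<Sum>x\<in>X. card (R `` {x}))"
    using fin finite_Image[OF finite_rel[OF unions_subset[OF R]]] card_SigmaI[of X "\<lambda>x. R `` {x}"] by auto
  also have "\<dots> = (\<Sum>x\<in>X. card (R `` {u}))"
    using out_degree_constant[OF R X(1) _ X(2)] by (intro sum.cong refl) blast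
  finally show ?thesis by simp
qed

definition restriction :: "'a set \<Rightarrow> 'a rel set" where
  "restriction Y = (\<lambda>T. T \<inter> Y \<times> Y) ` \<R> - {{}}"

lemma restriction_in_unions:
  assumes "F \<in> unions \<R>"
  shows "F \<inter> Y \<times> Y \<in> unions (restriction Y)"
proof -
  obtain \<X> where X: "\<X> \<subseteq> \<R>" "F = \<Union>\<X>" using assms by (auto simp: unions_def)
  have "F \<inter> Y \<times> Y = \<Union>((\<lambda>T. T \<inter> Y \<times> Y) ` \<X> - {{}})" using X by auto
  moreover have "(\<lambda>T. T \<inter> Y \<times> Y) ` \<X> - {{}} \<subseteq> restriction Y"
    using X by (auto simp: restriction_def)
  ultimately show ?thesis unfolding unions_def by blast
qed

lemma fibre_restriction:
  assumes "Id_on X \<in> \<R>" "Y \<subseteq> X" "Y \<noteq> {}"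
  shows "Id_on Y \<in> restriction Y"
proof -
  have "Id_on Y = Id_on X \<inter> Y \<times> Y" using assms by auto
  moreover have "Id_on Y \<noteq> {}" using assms by auto
  ultimately show ?thesis using assms(1) unfolding restriction_def by blast
qed

text \<open>A class \<open>Y\<close> of an equivalence that is a union of basis relations carries a scheme: a basis
  relation with a pair inside \<open>Y\<close> never leaves \<open>Y\<close> from a point of \<open>Y\<close>, so counting intermediate
  points in \<open>Y\<close> or in \<open>V\<close> makes no difference. The equivalence may be a partial one, which covers
  both the square of a fibre and equivalences on a homogeneous scheme.\<close>

lemma scheme_restriction:
  assumes E: "E \<in> unions \<R>" "sym E" "trans E" and y: "(y, y) \<in> E" and Y: "Y = E `` {y}"
  shows "scheme Y (restriction Y)"
proof -
  have YV: "Y \<subseteq> V" using unions_subset[OF E(1)] Y by auto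
  have YE: "Y \<times> Y \<subseteq> E" using Y E(2,3) by (auto dest: symD transD)
  have closed: "v \<in> Y" if "u \<in> Y" "(u, v) \<in> E" for u v
    using that Y E(3) by (auto dest: transD)
  have inE: "T \<subseteq> E" if "T \<in> \<R>" "T \<inter> Y \<times> Y \<noteq> {}" for T
    using unions_dichotomy[OF E(1) that(1)] that(2) YE by blast
  show ?thesis
  proof
    show "finite Y" using YV finite_points by (rule finite_subset)
    show "Y \<noteq> {}" using y Y by auto
    show "partition_on (Y \<times> Y) (restriction Y)"
    proof (rule partition_onI)
      have "\<Union>(restriction Y) = \<Union>\<R> \<inter> Y \<times> Y" by (auto simp: restriction_def)
      then show "\<Union>(restriction Y) = Y \<times> Y"
        using YV partition_onD1[OF partition] by auto
      show "disjnt S T" if ST: "S \<in> restriction Y" "T \<in> restriction Y" "S \<noteq> T" for S T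
      proof (rule ccontr)
        assume "\<not> disjnt S T"
        then obtain p where p: "p \<in> S" "p \<in> T" by (auto simp: disjnt_def)
        obtain S0 T0 where 0: "S0 \<in> \<R>" "S = S0 \<inter> Y \<times> Y" "T0 \<in> \<R>" "T = T0 \<inter> Y \<times> Y"
          using ST by (auto simp: restriction_def)
        then have "S0 = T0" using basis_eq[of S0 T0 p] p by simp
        then show False using 0 ST(3) by simp
      qed
      show "{} \<notin> restriction Y" by (simp add: restriction_def)
    qed
    fix R assume R: "R \<in> restriction Y"
    show "R\<inverse> \<in> restriction Y"
    proof -
      obtain T where T: "T \<in> \<R>" "R = T \<inter> Y \<times> Y" "R \<noteq> {}" using R by (auto simp: restriction_def)
      have "R\<inverse> = T\<inverse> \<inter> Y \<times> Y" "R\<inverse> \<noteq> {}" using T by auto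
      then show ?thesis using converse_closed[OF T(1)] by (auto simp: restriction_def)
    qed
  next
    have "Id_on Y = Id_on V \<inter> Y \<times> Y" using YV by auto
    then show "Id_on Y \<in> unions (restriction Y)" using restriction_in_unions[OF diagonal, of Y] by simp
  next
    fix R S T u w u' w'
    assume RST: "R \<in> restriction Y" "S \<in> restriction Y" "T \<in> restriction Y"
      and uw: "(u, w) \<in> T" "(u', w') \<in> T"
    obtain R0 S0 T0 where 0: "R0 \<in> \<R>" "R = R0 \<inter> Y \<times> Y" "R \<noteq> {}" "S0 \<in> \<R>" "S = S0 \<inter> Y \<times> Y"
      "T0 \<in> \<R>" "T = T0 \<inter> Y \<times> Y"
      using RST by (auto simp: restriction_def)
    have R0: "R0 \<subseteq> E" using inE 0 by blast
    have "path_count Y R S a b = path_count V R0 S0 a b" if ab: "a \<in> Y" "b \<in> Y" for a b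
    proof -
      have "{v \<in> Y. (a, v) \<in> R \<and> (v, b) \<in> S} = {v \<in> V. (a, v) \<in> R0 \<and> (v, b) \<in> S0}"
        using 0(2,5) YV R0 closed[OF ab(1)] ab by blast
      then show ?thesis by (simp add: path_count_def)
    qed
    moreover have "(u, w) \<in> T0" "(u', w') \<in> T0" "u \<in> Y" "w \<in> Y" "u' \<in> Y" "w' \<in> Y"
      using uw 0(7) by auto
    ultimately show "path_count Y R S u w = path_count Y R S u' w'"
      using coherent[OF 0(1,4,6), of u w u' w'] by simp
  qed
qed

text \<open>The coherence property that feeds \<open>tower_equitable_power_of_two\<close>. The relation \<open>F\<close> lives on \<open>Y\<close>
  only, but it agrees on \<open>Y\<close> with the union \<open>F'\<close> of all basis relations that it meets, and the number in
  question is the entry at \<open>(u, x)\<close> of the product of \<open>R\<close> with the converse of \<open>F'\<close>.\<close>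

lemma neighbourhood_equitable:
  assumes E: "E \<in> unions \<R>" "sym E" "trans E" and y: "(y, y) \<in> E" and Y: "Y = E `` {y}"
    and R: "R \<in> \<R>" and N: "R `` {u} \<subseteq> Y"
    and F: "F \<in> unions (restriction Y)" and x: "x \<in> R `` {u}" "x' \<in> R `` {u}"
  shows "card (R `` {u} \<inter> F `` {x}) = card (R `` {u} \<inter> F `` {x'})"
proof -
  interpret Y: scheme Y "restriction Y" using scheme_restriction[OF E y Y] .
  have YE: "Y \<times> Y \<subseteq> E" using Y E(2,3) by (auto dest: symD transD)
  have closed: "v \<in> Y" if "u \<in> Y" "(u, v) \<in> E" for u v
    using that Y E(3) by (auto dest: transD)
  define F' where "F' = \<Union>{T \<in> \<R>. T \<inter> Y \<times> Y \<noteq> {} \<and> T \<inter> Y \<times> Y \<subseteq> F}"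
  have F'_unions: "F' \<in> unions \<R>" unfolding F'_def unions_def by blast
  have F'_eq: "F `` {z} = F' `` {z}" if z: "z \<in> Y" for z
  proof (intro equalityI subsetI)
    fix v assume "v \<in> F `` {z}"
    then have v: "(z, v) \<in> F" by simp
    then have "(z, v) \<in> Y \<times> Y" using Y.unions_subset[OF F] by blast
    then have vY: "v \<in> Y" by simp
    have "z \<in> V" "v \<in> V" using z vY Y unions_subset[OF E(1)] by auto
    then obtain T where T: "T \<in> \<R>" "(z, v) \<in> T" using basis_cover by blast
    then have "T \<inter> Y \<times> Y \<in> restriction Y" using z vY by (auto simp: restriction_def)
    then have "T \<inter> Y \<times> Y \<subseteq> F"
      using Y.unions_dichotomy[OF F] T(2) z vY v by blast
    then show "v \<in> F' `` {z}" unfolding F'_def using T z vY by blast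
  next
    fix v assume "v \<in> F' `` {z}"
    then obtain T where T: "T \<in> \<R>" "(z, v) \<in> T" "T \<inter> Y \<times> Y \<noteq> {}" "T \<inter> Y \<times> Y \<subseteq> F"
      unfolding F'_def by blast
    have "T \<inter> E \<noteq> {}" using T(3) YE by blast
    then have "T \<subseteq> E" using unions_dichotomy[OF E(1) T(1)] by blast
    then have "(z, v) \<in> E" using T(2) by (rule subsetD)
    then have "v \<in> Y" by (rule closed[OF z])
    then show "v \<in> F `` {z}" using T z by blast
  qed
  have count: "card (R `` {u} \<inter> F `` {z}) = path_count V R (F'\<inverse>) u z" if z: "z \<in> R `` {u}" for z
  proof -
    have "R `` {u} \<inter> F' `` {z} = {v \<in> V. (u, v) \<in> R \<and> (v, z) \<in> F'\<inverse>}"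
      using basis_subset[OF R] by auto
    moreover have "z \<in> Y" using z N by blast
    ultimately show ?thesis unfolding path_count_def by (simp add: F'_eq)
  qed
  have "path_count V R (F'\<inverse>) u x = path_count V R (F'\<inverse>) u x'"
    by (rule invariantD[OF invariant_path_count[OF basis_in_unions[OF R] converse_in_unions[OF F'_unions]] R])
      (use x in simp_all)
  then show ?thesis using count[OF x(1)] count[OF x(2)] by simp
qed

lemma
  assumes X: "Id_on X \<in> \<R>"
  shows scheme_fibre: "scheme X (restriction X)"
    and fibre_homogeneous: "Id_on X \<in> restriction X"
    and restriction_fibre_subset: "restriction X \<subseteq> \<R>"
proof -
  obtain x where x: "x \<in> X" using fibre_nonempty[OF X] by blast
  show "scheme X (restriction X)"
    by (rule scheme_restriction[OF fibre_square_in_unions[OF X], of x])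
      (use x in \<open>auto simp: sym_def trans_def\<close>)
  show "Id_on X \<in> restriction X"
    using fibre_restriction[OF X subset_refl fibre_nonempty[OF X]] .
  show "restriction X \<subseteq> \<R>"
  proof
    fix S assume "S \<in> restriction X"
    then obtain T where T: "T \<in> \<R>" "S = T \<inter> X \<times> X" "S \<noteq> {}" by (auto simp: restriction_def)
    then have "T \<subseteq> X \<times> X" using unions_dichotomy[OF fibre_square_in_unions[OF X] T(1)] by simp
    then show "S \<in> \<R>" using T by (simp add: Int_absorb2)
  qed
qed

text \<open>The set of neighbours meets all classes of a relation in the same number of points or not at
  all, by \<open>neighbourhood_equitable\<close>, so \<open>tower_equitable_power_of_two\<close> applies to it and to the last
  member \<open>Y \<times> Y\<close>, which has a single class. The point \<open>u\<close> may lie in a different class or fibre.\<close>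

lemma neighbourhood_power_of_two:
  assumes E: "E \<in> unions \<R>" "sym E" "trans E" and y: "(y, y) \<in> E" and Y: "Y = E `` {y}"
    and R: "R \<in> \<R>" and N: "R `` {u} \<subseteq> Y" and x: "(u, x) \<in> R"
    and tower: "tower Y (unions (restriction Y)) (Y \<times> Y)"
  shows "power_of_two (card (R `` {u}))"
proof -
  have fin: "finite (R `` {u})" using finite_rel[OF basis_subset[OF R]] by (simp add: finite_Image)
  have "power_of_two (card (R `` {u} \<inter> (Y \<times> Y) `` {x}))"
    by (rule tower_equitable_power_of_two[OF tower N fin neighbourhood_equitable[OF E y Y R N]]) (use x in simp_all)
  moreover have "R `` {u} \<inter> (Y \<times> Y) `` {x} = R `` {u}" using N x by blast
  ultimately show ?thesis by simp
qed

section \<open>Homogeneous 2-schemes have towers\<close>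

text \<open>There are \<open>m * n * m\<close> walks from \<open>u\<close> of the form \<open>E\<close>, \<open>R\<close>, \<open>E\<close>, where \<open>n\<close> is the out-degree of \<open>R\<close>.
  They are distributed evenly over the endpoints, because the number of walks from \<open>u\<close> to \<open>v\<close> depends
  only on the classes of \<open>u\<close> and \<open>v\<close> and is constant on \<open>R\<close>. So the number of endpoints divides a
  power of two.\<close>

lemma double_coset_degree_power_of_two:
  assumes hom: "Id_on V \<in> \<R>" and pow: "\<And>R. R \<in> \<R> \<Longrightarrow> power_of_two (card R)"
    and E: "E \<in> unions \<R>" "equiv V E" and m: "\<And>v. v \<in> V \<Longrightarrow> card (E `` {v}) = m" "power_of_two m"
    and R: "R \<in> \<R>" and u: "u \<in> V"
  shows "power_of_two (card ((E O R O E) `` {u}))"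
proof -
  define n where "n = card (R `` {u})"
  have n: "card (R `` {v}) = n" if "v \<in> V" for v
    unfolding n_def using out_degree_constant[OF basis_in_unions[OF R] hom that u] .
  have "card R = card V * n"
    unfolding n_def using card_eq_fibre_times_out_degree[OF basis_in_unions[OF R] hom u] basis_subset[OF R] .
  then have pow_n: "power_of_two n" using power_of_two_dvd[OF pow[OF R]] by simp
  define D where "D = E O R O E"
  have D_sub: "D \<subseteq> V \<times> V"
    unfolding D_def using unions_subset relcomp_in_unions E(1) basis_in_unions[OF R] by blast
  define e where "e x y = (of_bool ((x, y) \<in> E) :: nat)" for x y
  define r where "r x y = (of_bool ((x, y) \<in> R) :: nat)" for x y
  \<comment> \<open>\<open>h x y\<close> counts the pairs of \<open>R\<close> between the classes of \<open>x\<close> and \<open>y\<close>.\<close>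
  define h where "h x y = (\<Sum>a\<in>V. e x a * (\<Sum>b\<in>V. r a b * e b y))" for x y
  have inv_h: "invariant h"
    unfolding h_def e_def r_def
    by (intro invariant_product[where f = "\<lambda>x y. of_bool ((x, y) \<in> E)"]
        invariant_product[where f = "\<lambda>x y. of_bool ((x, y) \<in> R)"]
        invariant_of_bool E(1) basis_in_unions[OF R])
  have symE: "sym E" "trans E" using E(2) by (auto simp: equiv_def)
  have e_cong: "e x a = e y a" "e a x = e a y" if "(x, y) \<in> E" for x y a
  proof -
    have "(x, a) \<in> E \<longleftrightarrow> (y, a) \<in> E" "(a, x) \<in> E \<longleftrightarrow> (a, y) \<in> E"
      using that symE by (blast dest: symD transD)+
    then show "e x a = e y a" "e a x = e a y" unfolding e_def by simp_all
  qed
  have h_cong: "h x v = h y w" if "(x, y) \<in> E" "(v, w) \<in> E" for x y v w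
    unfolding h_def using e_cong(1)[OF that(1)] e_cong(2)[OF that(2)] by simp
  have h_pos: "h x y > 0 \<longleftrightarrow> (x, y) \<in> D" for x y
  proof -
    have "h x y > 0 \<longleftrightarrow> (\<exists>a\<in>V. (x, a) \<in> E \<and> (\<exists>b\<in>V. (a, b) \<in> R \<and> (b, y) \<in> E))"
      unfolding h_def e_def r_def using finite_points by (auto simp: sum_nonneg_eq_0_iff simp flip: neq0_conv)
    also have "\<dots> \<longleftrightarrow> (x, y) \<in> D"
      unfolding D_def using basis_subset[OF R] by (auto simp: relcomp_unfold)
    finally show ?thesis .
  qed
  have h_const: "h u v = h u w" if vw: "(u, v) \<in> D" "(u, w) \<in> D" for v w
  proof -
    obtain u1 v1 where 1: "(u, u1) \<in> E" "(u1, v1) \<in> R" "(v1, v) \<in> E" using vw(1) unfolding D_def by blast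
    obtain u2 w2 where 2: "(u, u2) \<in> E" "(u2, w2) \<in> R" "(w2, w) \<in> E" using vw(2) unfolding D_def by blast
    have "h u v = h u1 v1" using h_cong 1(1,3) symE(1) by (meson symD)
    also have "\<dots> = h u2 w2" using invariantD[OF inv_h R 1(2) 2(2)] .
    also have "\<dots> = h u w" using h_cong 2(1,3) symE(1) by (meson symD)
    finally show ?thesis .
  qed
  have E_sub: "E `` {x} \<subseteq> V" and R_sub: "R `` {x} \<subseteq> V" for x
    using unions_subset[OF E(1)] basis_subset[OF R] by auto
  have row_e: "(\<Sum>y\<in>V. e x y) = m" if x: "x \<in> V" for x
  proof -
    have "{y \<in> V. (x, y) \<in> E} = E `` {x}" using E_sub[of x] by auto
    then show ?thesis unfolding e_def sum_of_bool_card[OF finite_points] using m(1)[OF x] by simp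
  qed
  have row_r: "(\<Sum>y\<in>V. r x y) = n" if x: "x \<in> V" for x
  proof -
    have "{y \<in> V. (x, y) \<in> R} = R `` {x}" using R_sub[of x] by auto
    then show ?thesis unfolding r_def sum_of_bool_card[OF finite_points] using n[OF x] by simp
  qed
  have row_product: "(\<Sum>y\<in>V. \<Sum>a\<in>V. f x a * g a y) = (\<Sum>a\<in>V. f x a * (\<Sum>y\<in>V. g a y))"
    for f g :: "'a \<Rightarrow> 'a \<Rightarrow> nat" and x
    by (subst sum.swap) (simp add: sum_distrib_left)
  have "(\<Sum>y\<in>V. h u y) = (\<Sum>a\<in>V. e u a * (\<Sum>b\<in>V. r a b * (\<Sum>y\<in>V. e b y)))"
    unfolding h_def row_product[where f = e] row_product[where f = r] ..
  also have "\<dots> = m * (n * m)"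
    using row_e[OF u] by (simp add: row_e row_r flip: sum_distrib_right)
  finally have row_h: "(\<Sum>y\<in>V. h u y) = m * (n * m)" .
  obtain v where v: "(u, v) \<in> R" "v \<in> V"
  proof -
    have "n \<noteq> 0" using power_of_two_pos[OF pow_n] by simp
    then have "R `` {u} \<noteq> {}" unfolding n_def by auto
    then show thesis using that R_sub[of u] by blast
  qed
  have "(u, u) \<in> E" "(v, v) \<in> E" using E(2) u v by (auto simp: equiv_def refl_on_def)
  then have uvD: "(u, v) \<in> D" unfolding D_def using v by blast
  have "(\<Sum>y\<in>V. h u y) = (\<Sum>y\<in>D `` {u}. h u y)"
  proof (rule sum.mono_neutral_right)
    show "\<forall>y\<in>V - D `` {u}. h u y = 0" using h_pos[of u] by (metis DiffD2 ImageI not_gr_zero singletonI)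
  qed (use finite_points D_sub in auto)
  also have "\<dots> = (\<Sum>y\<in>D `` {u}. h u v)" 
    by (intro sum.cong refl h_const uvD) simp
  also have "\<dots> = card (D `` {u}) * h u v" by simp
  finally have "card (D `` {u}) * h u v = m * (n * m)" using row_h by simp
  then have "card (D `` {u}) dvd m * (n * m)" by (metis dvd_triv_left)
  then show ?thesis
    using power_of_two_dvd[OF power_of_two_mult[OF m(2) power_of_two_mult[OF pow_n m(2)]]]
    unfolding D_def by simp
qed

text \<open>In the quotient by \<open>E\<close> the double cosets \<open>D\<close> become the basis relations, with out-degrees \<open>f D\<close>.
  These are powers of two with an even sum, and \<open>f E = 1\<close>. Since \<open>f\<close> is invariant under taking
  converses, the sum over the symmetric double cosets is even too, and this forces an odd \<open>f D\<close>,
  that is, \<open>f D = 1\<close>, for a symmetric \<open>D \<noteq> E\<close>. Such a \<open>D\<close> is an involution on the classes of \<open>E\<close>, and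
  its orbits are the classes of \<open>E \<union> D\<close>.\<close>

lemma exists_doubling:
  assumes hom: "Id_on V \<in> \<R>" and pow: "\<And>R. R \<in> \<R> \<Longrightarrow> power_of_two (card R)"
    and E: "E \<in> unions \<R>" "equiv V E" and m: "\<And>v. v \<in> V \<Longrightarrow> card (E `` {v}) = m" "power_of_two m"
    and proper: "E \<noteq> V \<times> V"
  obtains F where "F \<in> unions \<R>" "equiv V F" "E \<subset> F"
    "\<And>x y z. \<lbrakk>(x, y) \<in> F - E; (y, z) \<in> F - E\<rbrakk> \<Longrightarrow> (x, z) \<in> E"
proof -
  define \<D> where "\<D> = (\<lambda>R. E O R O E) ` \<R>"
  have symE: "sym E" "trans E" and reflE: "\<And>v. v \<in> V \<Longrightarrow> (v, v) \<in> E" and convE: "E\<inverse> = E"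
    using E(2) by (auto simp: equiv_def refl_on_def sym_conv_converse_eq)
  have D_unions: "D \<in> unions \<R>" if "D \<in> \<D>" for D
    using that E(1) unfolding \<D>_def by (auto intro!: relcomp_in_unions intro: basis_in_unions)
  have absorb: "(x, z) \<in> D" if D: "D \<in> \<D>" and xz: "(x, x') \<in> E" "(x', z') \<in> D" "(z', z) \<in> E" for D x x' z z'
  proof -
    obtain R where R: "D = E O R O E" using D unfolding \<D>_def by blast
    obtain a b where "(x', a) \<in> E" "(a, b) \<in> R" "(b, z') \<in> E" using xz(2) R by blast
    then have "(x, a) \<in> E" "(a, b) \<in> R" "(b, z) \<in> E" using xz symE(2) by (blast dest: transD)+
    then show ?thesis unfolding R by blast
  qed
  have D_eq: "D = D'" if D: "D \<in> \<D>" "D' \<in> \<D>" "p \<in> D" "p \<in> D'" for D D' p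
  proof -
    have sub: "D \<subseteq> D'" if D: "D \<in> \<D>" "D' \<in> \<D>" "p \<in> D" "p \<in> D'" for D D'
    proof -
      obtain R where R: "R \<in> \<R>" "D = E O R O E" using D unfolding \<D>_def by blast
      obtain x y where p: "p = (x, y)" by (cases p)
      obtain a b where ab: "(x, a) \<in> E" "(a, b) \<in> R" "(b, y) \<in> E" using D(3) R p by blast
      then have "(a, x) \<in> E" "(y, b) \<in> E" using symE(1) by (blast dest: symD)+
      then have "(a, b) \<in> D'" using absorb[OF D(2)] D(4) p by blast
      then have RD: "R \<subseteq> D'" using unions_dichotomy[OF D_unions[OF D(2)] R(1)] ab(2) by blast
      show "D \<subseteq> D'"
      proof (rule subrelI)
        fix s t assume "(s, t) \<in> D"
        then obtain a b where "(s, a) \<in> E" "(a, b) \<in> R" "(b, t) \<in> E" unfolding R by blast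
        then show "(s, t) \<in> D'" using absorb[OF D(2)] RD by blast
      qed
    qed
    show ?thesis using sub[OF D] sub[OF D(2,1,4,3)] by blast
  qed
  have D_cover: "\<exists>D\<in>\<D>. (x, y) \<in> D" if xy: "x \<in> V" "y \<in> V" for x y
  proof -
    obtain R where R: "R \<in> \<R>" "(x, y) \<in> R" using basis_cover[OF xy] by blast
    then have "(x, y) \<in> E O R O E" using reflE xy by blast
    then show ?thesis unfolding \<D>_def using R(1) by blast
  qed
  have "E O Id_on V O E = E" using unions_subset[OF E(1)] reflE symE(2) by (auto dest: transD)
  then have E_D: "E \<in> \<D>" unfolding \<D>_def using hom by (metis image_eqI)
  have D_conv: "D\<inverse> \<in> \<D>" if D: "D \<in> \<D>" for D
  proof -
    obtain R where R: "R \<in> \<R>" "D = E O R O E" using D unfolding \<D>_def by blast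
    have "D\<inverse> = E O R\<inverse> O E" unfolding R converse_relcomp convE by (simp add: O_assoc)
    then show ?thesis unfolding \<D>_def using converse_closed[OF R(1)] by blast
  qed
  have finD: "finite \<D>" unfolding \<D>_def using finite_basis by simp
  obtain u where u: "u \<in> V" using points_nonempty by blast
  have fin_Im: "finite (D `` {x})" if "D \<in> \<D>" for D x
    using finite_Image[OF finite_rel[OF unions_subset[OF D_unions[OF that]]]] by simp
  define d where "d D = card (D `` {u})" for D :: "'a rel"
  have d_all: "card (D `` {x}) = d D" if "D \<in> \<D>" "x \<in> V" for D x
    unfolding d_def using out_degree_constant[OF D_unions[OF that(1)] hom that(2) u] .
  have class_sub: "E `` {y} \<subseteq> D `` {x}" if "D \<in> \<D>" "(x, y) \<in> D" for D x y
    using absorb[OF that(1) _ that(2)] reflE unions_subset[OF D_unions[OF that(1)]] that(2) by auto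
  have d_pow: "power_of_two (d D)" if "D \<in> \<D>" for D
    using that double_coset_degree_power_of_two[OF hom pow E m _ u] unfolding \<D>_def d_def by blast
  have m_dvd: "m dvd d D" if D: "D \<in> \<D>" for D
  proof -
    have "d D \<noteq> 0" using power_of_two_pos[OF d_pow[OF D]] by simp
    then have "D `` {u} \<noteq> {}" unfolding d_def by (metis card.empty)
    then obtain y where y: "(u, y) \<in> D" by blast
    have "y \<in> V" using y unions_subset[OF D_unions[OF D]] by auto
    then have "m \<le> d D"
      using card_mono[OF fin_Im[OF D] class_sub[OF D y]] m(1) unfolding d_def by simp
    then show ?thesis using power_of_two_le_imp_dvd m(2) d_pow[OF D] by blast
  qed
  have m_pos: "m > 0" using power_of_two_pos[OF m(2)] .
  define f where "f D = d D div m" for D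
  have d_f: "d D = m * f D" if "D \<in> \<D>" for D unfolding f_def using m_dvd[OF that] by simp
  have "V = (\<Union>D\<in>\<D>. D `` {u})"
  proof (intro equalityI subsetI)
    fix x assume "x \<in> V"
    then show "x \<in> (\<Union>D\<in>\<D>. D `` {u})" using D_cover[OF u] by blast
  next
    fix x assume "x \<in> (\<Union>D\<in>\<D>. D `` {u})"
    then obtain D where D: "D \<in> \<D>" "(u, x) \<in> D" by blast
    then show "x \<in> V" using unions_subset[OF D_unions[OF D(1)]] by blast
  qed
  moreover have "card (\<Union>D\<in>\<D>. D `` {u}) = (\<Sum>D\<in>\<D>. d D)"
    unfolding d_def using finD fin_Im D_eq by (intro card_UN_disjoint) blast+
  ultimately have sum_d: "card V = m * (\<Sum>D\<in>\<D>. f D)"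
    using d_f by (simp add: sum_distrib_left)
  have pow_V: "power_of_two (card V)"
  proof -
    have "card (Id_on V) = card V * card (Id_on V `` {u})"
      using card_eq_fibre_times_out_degree[OF diagonal hom u] by blast
    then show ?thesis using power_of_two_dvd[OF pow[OF hom]] by simp
  qed
  have "(\<Sum>D\<in>\<D>. f D) \<noteq> 1"
  proof
    assume "(\<Sum>D\<in>\<D>. f D) = 1"
    then have "card V = m" using sum_d by simp
    then have "E `` {x} = V" if "x \<in> V" for x
      using card_subset_eq[OF finite_points, of "E `` {x}"] m(1)[OF that] unions_subset[OF E(1)] by auto
    then have "E = V \<times> V" using unions_subset[OF E(1)] by blast
    then show False using proper by simp
  qed
  moreover have "power_of_two (\<Sum>D\<in>\<D>. f D)" using power_of_two_dvd[OF pow_V] sum_d by simp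
  ultimately have even_f: "even (\<Sum>D\<in>\<D>. f D)" using power_of_two_odd by blast
  have V_pos: "card V > 0" using finite_points points_nonempty by (simp add: card_gt_0_iff)
  have f_conv: "f (D\<inverse>) = f D" if D: "D \<in> \<D>" for D
  proof -
    have "card V * d (D\<inverse>) = card (D\<inverse>)" "card V * d D = card D"
      unfolding d_def using card_eq_fibre_times_out_degree[OF D_unions hom u] unions_subset[OF D_unions]
        D D_conv[OF D] by metis+
    then have "card V * d (D\<inverse>) = card V * d D" by simp
    then show ?thesis using V_pos by (simp add: f_def)
  qed
  have "[(\<Sum>D\<in>\<D>. f D) = (\<Sum>D | D \<in> \<D> \<and> D\<inverse> = D. f D)] (mod 2)"
    by (rule sum_cong_fixed_points) (use two_is_prime_nat finD D_conv f_conv in \<open>simp_all add: eval_nat_numeral\<close>)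
  then have even_sym: "even (\<Sum>D | D \<in> \<D> \<and> D\<inverse> = D. f D)"
    using even_f by (simp add: cong_def even_iff_mod_2_eq_zero)
  have "f E = 1" unfolding f_def d_def using m(1)[OF u] m_pos by simp
  then have "(\<Sum>D | D \<in> \<D> \<and> D\<inverse> = D. f D) = 1 + (\<Sum>D\<in>{D \<in> \<D>. D\<inverse> = D} - {E}. f D)"
    using sum.remove[of "{D \<in> \<D>. D\<inverse> = D}" E f] finD E_D convE by simp
  then have "odd (\<Sum>D\<in>{D \<in> \<D>. D\<inverse> = D} - {E}. f D)" using even_sym by simp
  then obtain D where D: "D \<in> \<D>" "D\<inverse> = D" "D \<noteq> E" "odd (f D)"
    using dvd_sum[of "{D \<in> \<D>. D\<inverse> = D} - {E}" 2 f] by blast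
  have "power_of_two (f D)" using power_of_two_dvd[OF d_pow[OF D(1)], of "f D"] d_f[OF D(1)] by simp
  then have "f D = 1" using D(4) power_of_two_odd by blast
  then have "d D = m" using d_f[OF D(1)] by simp
  \<comment> \<open>Both sides have \<open>m\<close> elements: \<open>D\<close> matches the class of \<open>x\<close> with a single class.\<close>
  have D_class: "D `` {x} = E `` {y}" if xy: "(x, y) \<in> D" for x y
  proof -
    have "x \<in> V" "y \<in> V" using xy unions_subset[OF D_unions[OF D(1)]] by auto
    then have "card (E `` {y}) = card (D `` {x})" using d_all[OF D(1)] m(1) \<open>d D = m\<close> by simp
    then show ?thesis using card_subset_eq[OF fin_Im[OF D(1)] class_sub[OF D(1) xy]] by simp
  qed
  have D_sym: "(y, x) \<in> D" if "(x, y) \<in> D" for x y using that D(2) by blast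
  have D_D: "(x, z) \<in> E" if "(x, y) \<in> D" "(y, z) \<in> D" for x y z
    using D_class[OF D_sym[OF that(1)]] that(2) by blast
  have E_D': "(x, z) \<in> D" if "(x, y) \<in> E" "(y, z) \<in> D" for x y z
    using absorb[OF D(1) that] reflE unions_subset[OF D_unions[OF D(1)]] that(2) by blast
  have D_E': "(x, z) \<in> D" if "(x, y) \<in> D" "(y, z) \<in> E" for x y z
    using absorb[OF D(1) _ that] reflE unions_subset[OF D_unions[OF D(1)]] that(1) by blast
  show thesis
  proof (rule that[of "E \<union> D"])
    show "E \<union> D \<in> unions \<R>" using E(1) D_unions[OF D(1)] by (rule Un_in_unions)
    show "equiv V (E \<union> D)"
    proof (rule equivI)
      show "E \<union> D \<subseteq> V \<times> V" using unions_subset E(1) D_unions[OF D(1)] by blast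
      show "refl_on V (E \<union> D)" using reflE by (auto simp: refl_on_def)
      show "sym (E \<union> D)" using symE(1) D_sym by (auto simp: sym_def)
      show "trans (E \<union> D)"
        by (rule transI) (use symE(2) D_D E_D' D_E' in \<open>blast dest: transD\<close>)
    qed
    have "d D \<noteq> 0" using \<open>d D = m\<close> m_pos by simp
    then have "D `` {u} \<noteq> {}" unfolding d_def by (metis card.empty)
    then obtain y where y: "(u, y) \<in> D" by blast
    have "(u, y) \<notin> E" using D_eq[OF D(1) E_D y] D(3) by blast
    then show "E \<subset> E \<union> D" using y by blast
    show "(x, z) \<in> E" if "(x, y) \<in> E \<union> D - E" "(y, z) \<in> E \<union> D - E" for x y z
      using D_D[of x y z] that by blast
  qed
qed

text \<open>A maximal member of a tower must be everything, by \<open>exists_doubling\<close>. Its classes have 2-power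
  size by \<open>tower_equitable_power_of_two\<close> with \<open>N = V\<close>.\<close>

lemma tower_full:
  assumes hom: "Id_on V \<in> \<R>" and pow: "\<And>R. R \<in> \<R> \<Longrightarrow> power_of_two (card R)"
  shows "tower V (unions \<R>) (V \<times> V)"
proof -
  let ?T = "{E. tower V (unions \<R>) E}"
  have "?T \<subseteq> Pow (V \<times> V)" using tower_mem unions_subset by blast
  then have "finite ?T" using finite_points by (meson finite_Pow_iff finite_SigmaI finite_subset)
  moreover have "Id_on V \<in> ?T" using tower.base[OF diagonal] by simp
  ultimately obtain E where E: "tower V (unions \<R>) E" and max: "\<And>F. tower V (unions \<R>) F \<Longrightarrow> E \<subseteq> F \<Longrightarrow> E = F"
    using finite_has_maximal[of ?T] by blast
  have unions: "E \<in> unions \<R>" and equiv: "equiv V E" using E tower_mem tower_equiv by blast+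
  obtain u where u: "u \<in> V" using points_nonempty by blast
  have VE: "V \<inter> F `` {x} = F `` {x}" if "F \<in> unions \<R>" for F x using unions_subset[OF that] by blast
  have "power_of_two (card (V \<inter> E `` {u}))"
    by (rule tower_equitable_power_of_two[OF E subset_refl finite_points _ u])
      (simp add: VE, rule out_degree_constant[OF _ hom])
  then have m: "power_of_two (card (E `` {u}))" by (simp add: VE unions)
  have m': "card (E `` {v}) = card (E `` {u})" if "v \<in> V" for v
    using out_degree_constant[OF unions hom that u] .
  have "E = V \<times> V"
  proof (rule ccontr)
    assume "E \<noteq> V \<times> V"
    then obtain F where F: "F \<in> unions \<R>" "equiv V F" "E \<subset> F"
      "\<And>x y z. \<lbrakk>(x, y) \<in> F - E; (y, z) \<in> F - E\<rbrakk> \<Longrightarrow> (x, z) \<in> E"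
      using exists_doubling[OF hom pow unions equiv m' m] by blast
    have "tower V (unions \<R>) F" by (rule tower.step[OF E F(1,2) _ F(4)]) (use F(3) in auto)
    then show False using max F(3) by blast
  qed
  then show ?thesis using E by simp
qed

section \<open>An analogue of the theorem of Cauchy\<close>

text \<open>The number of walks from \<open>u\<close> to \<open>w\<close> that follow the given relations in turn, or the \<open>(u, w)\<close>
  entry of the product of their adjacency matrices. The use of \<open>Id_on V\<close> for the empty word makes it
  invariant also there.\<close>

primrec walks :: "'a rel list \<Rightarrow> 'a \<Rightarrow> 'a \<Rightarrow> nat" where
  "walks [] u w = of_bool ((u, w) \<in> Id_on V)"
| "walks (R # Rs) u w = (\<Sum>v\<in>V. of_bool ((u, v) \<in> R) * walks Rs v w)"

lemma invariant_walks: "set Rs \<subseteq> \<R> \<Longrightarrow> invariant (walks Rs)"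
proof (induction Rs)
  case Nil
  have "walks [] = (\<lambda>u w. of_bool ((u, w) \<in> Id_on V))" by (intro ext walks.simps(1))
  then show ?case using invariant_of_bool[OF diagonal] by metis
next
  case (Cons R Rs)
  then have "invariant (\<lambda>u w. \<Sum>v\<in>V. of_bool ((u, v) \<in> R) * walks Rs v w)"
    by (intro invariant_product[where f = "\<lambda>u v. of_bool ((u, v) \<in> R)"] invariant_of_bool basis_in_unions) auto
  moreover have "walks (R # Rs) = (\<lambda>u w. \<Sum>v\<in>V. of_bool ((u, v) \<in> R) * walks Rs v w)"
    by (intro ext walks.simps(2))
  ultimately show ?case by metis
qed

lemma walks_append:
  "u \<in> V \<Longrightarrow> walks (Rs @ Ss) u w = (\<Sum>v\<in>V. walks Rs u v * walks Ss v w)"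
proof (induction Rs arbitrary: u)
  case Nil
  have "(\<Sum>v\<in>V. walks [] u v * walks Ss v w) = (\<Sum>v\<in>V. if v = u then walks Ss v w else 0)"
    using Nil by (intro sum.cong refl) auto
  then show ?case using Nil finite_points by simp
next
  case (Cons R Rs)
  have "walks ((R # Rs) @ Ss) u w =
      (\<Sum>x\<in>V. \<Sum>v\<in>V. of_bool ((u, x) \<in> R) * walks Rs x v * walks Ss v w)"
    using Cons.IH by (simp add: sum_distrib_left mult.assoc)
  also have "\<dots> = (\<Sum>v\<in>V. walks (R # Rs) u v * walks Ss v w)"
    by (subst sum.swap) (simp add: sum_distrib_right)
  finally show ?case .
qed

text \<open>A matrix product has the same trace after rotation of its factors, and in a homogeneous scheme
  the diagonal entries are all equal.\<close>

lemma closed_walks_rotate: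
  assumes hom: "Id_on V \<in> \<R>" and Rs: "set Rs \<subseteq> \<R>" and u: "u \<in> V"
  shows "walks (rotate1 Rs) u u = walks Rs u u"
proof (cases Rs)
  case (Cons R Ss)
  have trace: "(\<Sum>v\<in>V. walks Ts v v) = card V * walks Ts u u" if "set Ts \<subseteq> \<R>" for Ts
    using invariant_diagonal[OF invariant_walks[OF that] hom _ u] by simp
  have "(\<Sum>v\<in>V. walks (Ss @ [R]) v v) = (\<Sum>v\<in>V. \<Sum>x\<in>V. walks Ss v x * walks [R] x v)"
    by (intro sum.cong refl walks_append)
  also have "\<dots> = (\<Sum>x\<in>V. \<Sum>v\<in>V. walks [R] x v * walks Ss v x)"
    by (subst sum.swap) (simp only: mult.commute)
  also have "\<dots> = (\<Sum>x\<in>V. walks ([R] @ Ss) x x)"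
    by (intro sum.cong refl walks_append[symmetric])
  finally have "card V * walks (Ss @ [R]) u u = card V * walks ([R] @ Ss) u u"
    using trace[of "Ss @ [R]"] trace[of "[R] @ Ss"] Rs Cons by simp
  moreover have "card V > 0" using finite_points u by (auto simp: card_gt_0_iff)
  ultimately show ?thesis using Cons by simp
qed simp

text \<open>A walk with \<open>Suc n\<close> steps determines the word that it follows, so the sum counts the choices of
  the \<open>n\<close> inner points of the walk.\<close>

lemma sum_walks:
  assumes "u \<in> V" "w \<in> V"
  shows "(\<Sum>Rs | set Rs \<subseteq> \<R> \<and> length Rs = Suc n. walks Rs u w) = card V ^ n"
  using assms
proof (induction n arbitrary: u)
  have step: "(\<Sum>Rs | set Rs \<subseteq> \<R> \<and> length Rs = Suc n. walks Rs u w) =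
      (\<Sum>v\<in>V. \<Sum>Rs | set Rs \<subseteq> \<R> \<and> length Rs = n. walks Rs v w)" if u: "u \<in> V" for n u
  proof -
    let ?W = "{Rs. set Rs \<subseteq> \<R> \<and> length Rs = n}"
    have one: "(\<Sum>R\<in>\<R>. of_bool ((u, v) \<in> R)) = (1::nat)" if v: "v \<in> V" for v
    proof -
      obtain R where R: "R \<in> \<R>" "(u, v) \<in> R" using basis_cover[OF u v] by blast
      have "{S \<in> \<R>. (u, v) \<in> S} = {R}" using R basis_eq[OF _ R(1) _ R(2)] by blast
      then show ?thesis using sum_of_bool_card[OF finite_basis] by simp
    qed
    have "(\<Sum>Rs | set Rs \<subseteq> \<R> \<and> length Rs = Suc n. walks Rs u w) =
        (\<Sum>(Rs, R)\<in>?W \<times> \<R>. walks (R # Rs) u w)"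
      unfolding lists_length_Suc_eq by (subst sum.reindex) (auto simp: inj_on_def case_prod_beta)
    also have "\<dots> = (\<Sum>Rs\<in>?W. \<Sum>R\<in>\<R>. \<Sum>v\<in>V. of_bool ((u, v) \<in> R) * walks Rs v w)"
      by (simp only: sum.cartesian_product[symmetric] walks.simps(2))
    also have "\<dots> = (\<Sum>Rs\<in>?W. \<Sum>v\<in>V. \<Sum>R\<in>\<R>. of_bool ((u, v) \<in> R) * walks Rs v w)"
      by (intro sum.cong refl sum.swap)
    also have "\<dots> = (\<Sum>Rs\<in>?W. \<Sum>v\<in>V. walks Rs v w)"
      using one by (simp flip: sum_distrib_right)
    also have "\<dots> = (\<Sum>v\<in>V. \<Sum>Rs\<in>?W. walks Rs v w)" by (rule sum.swap)
    finally show ?thesis .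
  qed
  {
    case 0
    have "{Rs. set Rs \<subseteq> \<R> \<and> length Rs = 0} = {[]}" by auto
    then have "(\<Sum>Rs | set Rs \<subseteq> \<R> \<and> length Rs = Suc 0. walks Rs u w) = (\<Sum>v\<in>V. walks [] v w)"
      using step[OF 0(1), of 0] by simp
    also have "\<dots> = (\<Sum>v\<in>V. if v = w then 1 else 0)" using 0 by (intro sum.cong refl) auto
    finally show ?case using 0 finite_points by simp
  next
    case (Suc n)
    then show ?case using step[OF Suc.prems(1), of "Suc n"] by simp
  }
qed

lemma walks_replicate_colour:
  assumes c: "\<And>x y. (x, y) \<in> R \<Longrightarrow> (c x :: bool) \<noteq> c y"
  shows "walks (replicate k R) u w > 0 \<Longrightarrow> (c u = c w) \<longleftrightarrow> even k"
proof (induction k arbitrary: u)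
  case 0 then show ?case by (simp split: if_splits) auto
next
  case (Suc k)
  then obtain v where v: "v \<in> V" "of_bool ((u, v) \<in> R) * walks (replicate k R) v w > 0"
    using sum.neutral[of V "\<lambda>v. of_bool ((u, v) \<in> R) * walks (replicate k R) v w"]
    by (metis gr0I not_gr_zero replicate_Suc walks.simps(2))
  then have "(u, v) \<in> R" "walks (replicate k R) v w > 0" by (simp_all split: if_splits)
  then show ?case using Suc.IH[of v] c[of u v] by auto
qed

lemma walks_replicate_Id: "u \<in> V \<Longrightarrow> walks (replicate k (Id_on V)) u u = 1"
proof (induction k)
  case (Suc k)
  have "walks (replicate (Suc k) (Id_on V)) u u =
      (\<Sum>v\<in>V. if v = u then walks (replicate k (Id_on V)) v u else 0)"
    using Suc.prems by (auto intro!: sum.cong)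
  then show ?case using Suc finite_points by simp
qed auto

text \<open>McKay's proof of Cauchy's theorem, with words of relations in place of words of group elements.
  If an odd prime \<open>q\<close> divides the number of points, then it divides the number of closed walks of
  length \<open>q\<close> at \<open>u\<close>. Rotation acts on their words, so up to multiples of \<open>q\<close> only the constant
  words count. The diagonal contributes exactly one closed walk, and the other basis relations none, as
  a two-coloured relation has no closed walks of odd length.\<close>

lemma card_power_of_two_if_bicolourable:
  assumes hom: "Id_on V \<in> \<R>" and bic: "\<And>R. R \<in> \<R> \<Longrightarrow> R \<noteq> Id_on V \<Longrightarrow> bicolourable R"
  shows "power_of_two (card V)"
proof (rule power_of_two_if_no_odd_prime)
  show "card V > 0" using finite_points points_nonempty by (simp add: card_gt_0_iff)
  fix q :: nat assume q: "prime q" "odd q"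
  show "\<not> q dvd card V"
  proof
    assume dvd: "q dvd card V"
    obtain u where u: "u \<in> V" using points_nonempty by blast
    define W where "W = {Rs. set Rs \<subseteq> \<R> \<and> length Rs = q}"
    obtain n where n: "q = Suc (Suc n)" using prime_ge_2_nat[OF q(1)] by (metis add_2_eq_Suc le_Suc_ex)
    have finW: "finite W" unfolding W_def using finite_lists_length_eq[OF finite_basis] .
    have "[(\<Sum>Rs\<in>W. walks Rs u u) = (\<Sum>Rs | Rs \<in> W \<and> rotate1 Rs = Rs. walks Rs u u)] (mod q)"
    proof (rule sum_cong_fixed_points[OF q(1) finW])
      fix Rs assume Rs: "Rs \<in> W"
      show "rotate1 Rs \<in> W" using Rs by (simp add: W_def)
      show "(rotate1 ^^ q) Rs = Rs"
        using rotate_id[of q Rs] Rs by (simp add: W_def rotate_def)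
      show "walks (rotate1 Rs) u u = walks Rs u u"
        using closed_walks_rotate[OF hom _ u] Rs by (simp add: W_def)
    qed
    moreover have "(\<Sum>Rs | Rs \<in> W \<and> rotate1 Rs = Rs. walks Rs u u) = 1"
    proof -
      have "{Rs \<in> W. rotate1 Rs = Rs} = (\<lambda>R. replicate q R) ` \<R>"
      proof (intro equalityI subsetI)
        fix Rs assume "Rs \<in> {Rs \<in> W. rotate1 Rs = Rs}"
        then have Rs: "set Rs \<subseteq> \<R>" "length Rs = q" "rotate1 Rs = Rs" by (auto simp: W_def)
        then obtain R where R: "Rs = replicate q R" using rotate1_fixed_iff_constant[of Rs] n by auto
        then have "R \<in> \<R>" using Rs(1) n by simp
        then show "Rs \<in> (\<lambda>R. replicate q R) ` \<R>" using R by blast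
      next
        fix Rs assume "Rs \<in> (\<lambda>R. replicate q R) ` \<R>"
        then obtain R where "R \<in> \<R>" "Rs = replicate q R" by blast
        then show "Rs \<in> {Rs \<in> W. rotate1 Rs = Rs}"
          using rotate1_fixed_iff_constant[of Rs] n by (auto simp: W_def)
      qed
      moreover have "inj_on (\<lambda>R. replicate q R) \<R>" using n by (auto intro: inj_onI)
      ultimately have "(\<Sum>Rs | Rs \<in> W \<and> rotate1 Rs = Rs. walks Rs u u) =
          (\<Sum>R\<in>\<R>. walks (replicate q R) u u)"
        by (simp only: sum.reindex comp_def)
      also have "\<dots> = (\<Sum>R\<in>{Id_on V}. walks (replicate q R) u u)"
      proof (rule sum.mono_neutral_right)
        show "\<forall>R\<in>\<R> - {Id_on V}. walks (replicate q R) u u = 0"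
        proof
          fix R assume "R \<in> \<R> - {Id_on V}"
          then obtain c :: "'a \<Rightarrow> bool" where c: "\<And>x y. (x, y) \<in> R \<Longrightarrow> c x \<noteq> c y"
            using bic[of R] bicolourableE[of R] by (metis DiffE singletonI)
          show "walks (replicate q R) u u = 0"
            using walks_replicate_colour[of R c q u u] c q(2) by (metis gr0I)
        qed
      qed (use finite_basis hom in auto)
      also have "\<dots> = 1" using walks_replicate_Id[OF u] by simp
      finally show ?thesis .
    qed
    moreover have "(\<Sum>Rs\<in>W. walks Rs u u) = card V ^ Suc n"
      unfolding W_def n by (rule sum_walks[OF u u])
    moreover have "q dvd card V ^ Suc n" using dvd by simp
    ultimately have "q dvd 1" by (metis cong_dvd_iff)
    then show False using q(1) by (metis not_prime_unit)
  qed
qed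

end

section \<open>The two implications\<close>

text \<open>Induction on the number of points. For a nondiagonal \<open>R\<close> and a pair \<open>(u, x)\<close> in it, the points
  reached from \<open>x\<close> by an even number of steps along \<open>R\<close> or its converse form a set \<open>Y\<close> that contains all
  \<open>R\<close>-neighbours of \<open>u\<close>, but not \<open>u\<close> itself, since even walks preserve the colour. So the
  induction hypothesis makes the restriction to \<open>Y\<close> a 2-scheme.\<close>

lemma homogeneous_bicolourable_power_of_two:
  assumes "scheme V \<R>" "Id_on V \<in> \<R>" "\<And>R. R \<in> \<R> \<Longrightarrow> R \<noteq> Id_on V \<Longrightarrow> bicolourable R" "R \<in> \<R>"
  shows "power_of_two (card R)"
  using assms
proof (induction "card V" arbitrary: V \<R> R rule: less_induct)
  case less
  interpret scheme V \<R> by fact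
  note hom = \<open>Id_on V \<in> \<R>\<close> and bic = less.prems(3) and R = \<open>R \<in> \<R>\<close>
  have pow_V: "power_of_two (card V)" using card_power_of_two_if_bicolourable[OF hom bic] .
  obtain u x where ux: "(u, x) \<in> R" using basis_nonempty[OF R] by fastforce
  have u: "u \<in> V" "x \<in> V" using ux basis_subset[OF R] by auto
  have card_R: "card R = card V * card (R `` {u})"
    using card_eq_fibre_times_out_degree[OF basis_in_unions[OF R] hom u(1) basis_subset[OF R]] .
  have "power_of_two (card (R `` {u}))"
  proof (cases "R = Id_on V")
    case True
    then have "R `` {u} = {u}" using u by auto
    then show ?thesis by simp
  next
    case False
    obtain c :: "'a \<Rightarrow> bool" where c: "\<And>a b. (a, b) \<in> R \<Longrightarrow> c a \<noteq> c b"
      using bic[OF R False] by (rule bicolourableE) (rule that)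
    define G where "G = R \<union> R\<inverse>"
    define E where "E = (G O G)\<^sup>+"
    have G: "G \<in> unions \<R>" unfolding G_def using R by (intro Un_in_unions converse_in_unions basis_in_unions)
    have "(G O G)\<inverse> = G O G" unfolding converse_relcomp by (simp add: G_def converse_Un Un_commute)
    then have "sym (G O G)" by (simp add: sym_conv_converse_eq)
    then have E: "E \<in> unions \<R>" "sym E" "trans E"
      unfolding E_def using G by (simp_all add: trancl_in_unions relcomp_in_unions sym_trancl)
    have G_c: "c a \<noteq> c b" if "(a, b) \<in> G" for a b using that c[of a b] c[of b a] unfolding G_def by blast
    have E_c: "c a = c b" if "(a, b) \<in> E" for a b
      using that unfolding E_def
    proof (induction rule: trancl_induct)
      case (base b)
      then obtain d where "(a, d) \<in> G" "(d, b) \<in> G" by blast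
      then show ?case using G_c[of a d] G_c[of d b] by simp
    next
      case (step b d)
      from step.hyps(2) obtain e where "(b, e) \<in> G" "(e, d) \<in> G" by blast
      then show ?case using G_c[of b e] G_c[of e d] step.IH by simp
    qed
    have xE: "(x, y) \<in> E" if "(u, y) \<in> R" for y
    proof -
      have "(x, u) \<in> G" "(u, y) \<in> G" using ux that unfolding G_def by auto
      then show ?thesis unfolding E_def by blast
    qed
    define Y where "Y = E `` {x}"
    have N: "R `` {u} \<subseteq> Y" using xE unfolding Y_def by blast
    have "u \<notin> Y" using E_c[of x u] c[OF ux] unfolding Y_def by auto
    moreover have YV: "Y \<subseteq> V" using unions_subset[OF E(1)] unfolding Y_def by blast
    ultimately have smaller: "card Y < card V" using u(1) finite_points by (intro psubset_card_mono) auto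
    interpret Y: scheme Y "restriction Y" using scheme_restriction[OF E xE[OF ux] Y_def] .
    have hom_Y: "Id_on Y \<in> restriction Y" using fibre_restriction[OF hom YV Y.points_nonempty] .
    have bic_Y: "bicolourable S" if S: "S \<in> restriction Y" "S \<noteq> Id_on Y" for S
    proof -
      obtain T where T: "T \<in> \<R>" "S = T \<inter> Y \<times> Y" using S(1) by (auto simp: restriction_def)
      have "Id_on V \<inter> Y \<times> Y = Id_on Y" using YV by auto
      then have "T \<noteq> Id_on V" using T S(2) by auto
      then show ?thesis using bicolourable_mono[OF bic[OF T(1)]] T(2) by simp
    qed
    have "power_of_two (card S)" if "S \<in> restriction Y" for S
      using less.hyps[OF smaller Y.scheme_axioms hom_Y bic_Y that] .
    then have "tower Y (unions (restriction Y)) (Y \<times> Y)" by (rule Y.tower_full[OF hom_Y])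
    then show ?thesis
      using neighbourhood_power_of_two[OF E xE[OF ux] Y_def R N ux] by blast
  qed
  then show ?case unfolding card_R using power_of_two_mult[OF pow_V] by blast
qed

context scheme
begin

text \<open>Between two different fibres, membership in the first one is a colouring. Within a fibre, the
  tower of \<open>tower_full\<close> provides one.\<close>

lemma bicolourable_if_powers_of_two:
  assumes pow: "\<And>R. R \<in> \<R> \<Longrightarrow> power_of_two (card R)" and R: "R \<in> \<R>"
  shows "bicolourable (R - Id)"
proof (cases "R \<subseteq> Id_on V")
  case True
  then have "R - Id = {}" by blast
  then show ?thesis by (auto intro: bicolourableI)
next
  case False
  then have irrefl: "R \<inter> Id = {}" using basis_diagonal_or_irreflexive[OF R] by blast
  obtain u x where ux: "(u, x) \<in> R" using basis_nonempty[OF R] by fastforce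
  have V: "u \<in> V" "x \<in> V" using ux basis_subset[OF R] by auto
  obtain Z where Z: "Id_on Z \<in> \<R>" "u \<in> Z" using fibre_exists[OF V(1)] .
  obtain X where X: "Id_on X \<in> \<R>" "x \<in> X" using fibre_exists[OF V(2)] .
  have RZX: "R \<subseteq> Z \<times> X" using basis_between_fibres[OF R Z(1) X(1) ux Z(2) X(2)] .
  have "bicolourable R"
  proof (cases "Z = X")
    case True
    interpret X: scheme X "restriction X" using scheme_fibre[OF X(1)] .
    have "R = R \<inter> X \<times> X" using RZX True by blast
    then have R_X: "R \<in> restriction X" using R basis_nonempty[OF R] unfolding restriction_def by blast
    have "tower X (unions (restriction X)) (X \<times> X)"
      using X.tower_full[OF fibre_homogeneous[OF X(1)]] pow restriction_fibre_subset[OF X(1)] by blast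
    then show ?thesis
      by (rule tower_bicolourable) (use X.unions_dichotomy R_X X.basis_subset irrefl in auto)
  next
    case False
    have "Z \<inter> X = {}"
    proof (rule ccontr)
      assume "Z \<inter> X \<noteq> {}"
      then obtain v where "v \<in> Z" "v \<in> X" by blast
      then have "Id_on Z = Id_on X" using basis_eq[OF Z(1) X(1), of "(v, v)"] by auto
      then show False using False by (metis Domain_Id_on)
    qed
    then show ?thesis using RZX by (intro bicolourableI[of R "\<lambda>v. v \<in> Z"]) auto
  qed
  then show ?thesis by (rule bicolourable_mono) blast
qed

text \<open>For \<open>R\<close> between the fibres \<open>Z\<close> and \<open>X\<close>, both the size of \<open>Z\<close> and the out-degree of \<open>R\<close> are powers
  of two, because the homogeneous schemes on \<open>Z\<close> and \<open>X\<close> are 2-schemes; the out-degree is controlled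
  by the tower on \<open>X\<close>.\<close>

lemma powers_of_two_if_bicolourable:
  assumes bic: "\<And>R. R \<in> \<R> \<Longrightarrow> bicolourable (R - Id)" and R: "R \<in> \<R>"
  shows "power_of_two (card R)"
proof -
  have fibre_pow: "power_of_two (card S)" if X: "Id_on X \<in> \<R>" and S: "S \<in> restriction X" for X S
  proof (rule homogeneous_bicolourable_power_of_two[OF scheme_fibre[OF X] fibre_homogeneous[OF X] _ S])
    fix T assume T: "T \<in> restriction X" "T \<noteq> Id_on X"
    have T': "T \<in> \<R>" "T \<subseteq> X \<times> X" "T \<noteq> {}"
      using T(1) restriction_fibre_subset[OF X] by (auto simp: restriction_def)
    have "\<not> T \<subseteq> Id_on V"
    proof
      assume "T \<subseteq> Id_on V"
      then obtain v where "(v, v) \<in> T" "v \<in> X" using T' by blast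
      then show False using basis_eq[OF T'(1) X, of "(v, v)"] T(2) by blast
    qed
    then have "T - Id = T" using basis_diagonal_or_irreflexive[OF T'(1)] by blast
    then show "bicolourable T" using bic[OF T'(1)] by simp
  qed
  obtain u x where ux: "(u, x) \<in> R" using basis_nonempty[OF R] by fastforce
  have V: "u \<in> V" "x \<in> V" using ux basis_subset[OF R] by auto
  obtain Z where Z: "Id_on Z \<in> \<R>" "u \<in> Z" using fibre_exists[OF V(1)] .
  obtain X where X: "Id_on X \<in> \<R>" "x \<in> X" using fibre_exists[OF V(2)] .
  have RZX: "R \<subseteq> Z \<times> X" using basis_between_fibres[OF R Z(1) X(1) ux Z(2) X(2)] .
  interpret X: scheme X "restriction X" using scheme_fibre[OF X(1)] .
  have "tower X (unions (restriction X)) (X \<times> X)"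
    using X.tower_full[OF fibre_homogeneous[OF X(1)] fibre_pow[OF X(1)]] .
  then have "power_of_two (card (R `` {u}))"
    by (intro neighbourhood_power_of_two[OF fibre_square_in_unions[OF X(1)] _ _ _ _ R _ ux, of x X])
      (use X RZX in \<open>auto simp: sym_def trans_def\<close>)
  moreover have "power_of_two (card Z)"
  proof -
    have "card (Id_on Z) = card Z * card (Id_on Z `` {u})"
      using card_eq_fibre_times_out_degree[OF basis_in_unions[OF Z(1)] Z] fibre_subset[OF Z(1)] by blast
    then show ?thesis
      using power_of_two_dvd[OF fibre_pow[OF Z(1) fibre_homogeneous[OF Z(1)]]] by simp
  qed
  moreover have "card R = card Z * card (R `` {u})"
    using card_eq_fibre_times_out_degree[OF basis_in_unions[OF R] Z] RZX fibre_subset[OF X(1)] by blast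
  ultimately show ?thesis using power_of_two_mult by simp
qed

end

theorem corollary1p2:
  fixes V :: "'a set" and \<R> :: "'a rel set"
  assumes "scheme V \<R>"
  shows "two_scheme V \<R> \<longleftrightarrow> (\<forall>G \<in> basis_graphs V \<R>. bipartite G)"
proof -
  interpret scheme V \<R> by fact
  have graphs: "(\<forall>G \<in> basis_graphs V \<R>. bipartite G) \<longleftrightarrow> (\<forall>R\<in>\<R>. bicolourable (R - Id))"
    using bipartite_basis_graph_iff[OF basis_subset] by (simp add: basis_graphs_def)
  have "two_scheme V \<R> \<longleftrightarrow> (\<forall>R\<in>\<R>. power_of_two (card R))"
    using assms by (simp add: two_scheme_def power_of_two_def)
  also have "\<dots> \<longleftrightarrow> (\<forall>R\<in>\<R>. bicolourable (R - Id))"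
    using bicolourable_if_powers_of_two powers_of_two_if_bicolourable by blast
  finally show ?thesis unfolding graphs .
qed

end
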